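(* Let $G$ be a countable, infinite group. Then: (i) For every minimal, metrizable $G$-flow $X$, there exists a minimal, metrizable, free $G$-flow $Y$ such that $X$ and $Y$ are disjoint. (ii) There exist continuum many mutually disjoint, free, metrizable, minimal $G$-flows.
   Context: A $G$-flow is a compact Hausdorff space with an action of $G$ by homeomorphisms; it is minimal if every orbit is dense, and free if for every point $x$ the map $g\mapsto g\cdot x$ is injective. Two $G$-flows $X,Y$ are disjoint if the only closed $G$-invariant subset of $X\times Y$ projecting onto both factors is $X\times Y$. A family $\{X_i:i\in I\}$ of minimal $G$-flows is mutually disjoint if the product $\prod_{i\in I}X_i$ (with the diagonal action) is minimal. *)

theory Defs
  imports "HOL-Analysis.Analysis" "HOL-Algebra.Group"
begin

text \<open>A G-flow: a nonempty compact Hausdorff space X with a (left) action a of the group G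
  by continuous maps (hence homeomorphisms, since a g has continuous inverse a (inv g)).\<close>
definition G_flow :: "('g, 'b) monoid_scheme \<Rightarrow> 'x topology \<Rightarrow> ('g \<Rightarrow> 'x \<Rightarrow> 'x) \<Rightarrow> bool" where
  "G_flow G X a \<longleftrightarrow> group G \<and> compact_space X \<and> Hausdorff_space X \<and> topspace X \<noteq> {} \<and>
     (\<forall>g\<in>carrier G. continuous_map X X (a g)) \<and>
     (\<forall>x\<in>topspace X. a \<one>\<^bsub>G\<^esub> x = x) \<and>
     (\<forall>g\<in>carrier G. \<forall>h\<in>carrier G. \<forall>x\<in>topspace X. a (g \<otimes>\<^bsub>G\<^esub> h) x = a g (a h x))"

definition orbit :: "('g, 'b) monoid_scheme \<Rightarrow> ('g \<Rightarrow> 'x \<Rightarrow> 'x) \<Rightarrow> 'x \<Rightarrow> 'x set" where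
  "orbit G a x = (\<lambda>g. a g x) ` carrier G"

definition minimal_flow :: "('g, 'b) monoid_scheme \<Rightarrow> 'x topology \<Rightarrow> ('g \<Rightarrow> 'x \<Rightarrow> 'x) \<Rightarrow> bool" where
  "minimal_flow G X a \<longleftrightarrow> G_flow G X a \<and>
     (\<forall>x\<in>topspace X. X closure_of (orbit G a x) = topspace X)"

definition free_flow :: "('g, 'b) monoid_scheme \<Rightarrow> 'x topology \<Rightarrow> ('g \<Rightarrow> 'x \<Rightarrow> 'x) \<Rightarrow> bool" where
  "free_flow G X a \<longleftrightarrow> G_flow G X a \<and> (\<forall>x\<in>topspace X. inj_on (\<lambda>g. a g x) (carrier G))"

definition disjoint_flows :: "('g, 'b) monoid_scheme \<Rightarrow> 'x topology \<Rightarrow> ('g \<Rightarrow> 'x \<Rightarrow> 'x)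
    \<Rightarrow> 'y topology \<Rightarrow> ('g \<Rightarrow> 'y \<Rightarrow> 'y) \<Rightarrow> bool" where
  "disjoint_flows G X a Y b \<longleftrightarrow>
     (\<forall>Z. closedin (prod_topology X Y) Z \<and>
          (\<forall>g\<in>carrier G. \<forall>p\<in>Z. (a g (fst p), b g (snd p)) \<in> Z) \<and>
          fst ` Z = topspace X \<and> snd ` Z = topspace Y
          \<longrightarrow> Z = topspace X \<times> topspace Y)"

definition diag_action :: "'i set \<Rightarrow> ('i \<Rightarrow> 'g \<Rightarrow> 'x \<Rightarrow> 'x) \<Rightarrow> 'g \<Rightarrow> ('i \<Rightarrow> 'x) \<Rightarrow> ('i \<Rightarrow> 'x)" where
  "diag_action I a g f = (\<lambda>i\<in>I. a i g (f i))"

definition mutually_disjoint :: "('g, 'b) monoid_scheme \<Rightarrow> 'i set \<Rightarrow> ('i \<Rightarrow> 'x topology)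
    \<Rightarrow> ('i \<Rightarrow> 'g \<Rightarrow> 'x \<Rightarrow> 'x) \<Rightarrow> bool" where
  "mutually_disjoint G I X a \<longleftrightarrow>
     (\<forall>i\<in>I. minimal_flow G (X i) (a i)) \<and>
     minimal_flow G (product_topology X I) (diag_action I a)"

end

theory Submission
  imports Defs
begin

text \<open>
  Call a closed invariant set of ternary configurations irreducible if configurations prescribed on
  non-adjacent regions can be glued, for some invariant locally finite adjacency. Making a pattern of
  such a shift recur within bounded gaps leaves it irreducible. Given a minimal flow \<open>X\<close> and finitely
  many irreducible shifts, one can shrink the shifts so that \<open>X\<close> and given patterns in all of them are hit at
  a common time: by induction the hitting times for all but one shift contain, along a syndetic set,
  translates of a large finite set \<open>B\<close>, and the local lemma (in the manner of Bernshteyn's proof of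
  Bernoulli disjointness) gives a finite separated set meeting all these translates, on which the pattern
  of the last shift can be planted. Iterating along a binary tree that starts with a free irreducible
  shift and intersecting along the branches yields continuum many free flows whose product with \<open>X\<close> is
  minimal. Part (i) uses one branch, part (ii) the one-point flow \<open>X\<close>.
\<close>

section \<open>Separated hitting sets\<close>

text \<open>The obstacle is the order of choices. The set \<open>B\<close> of return times has to be
  fixed before the neighbourhood from which all of them can be read off, and only then is the finite
  set \<open>K2\<close> of times known; so the size of \<open>B\<close> must not depend on how many
  translates of \<open>B\<close> are to be met. A local lemma allows this, because it weighs a bad
  event only against events sharing a vertex with it: for \<open>N\<close> cells of size
  \<open>d\<close> the bad patterns have proportion \<open>(1 - 2^(-d))^N\<close>, while the degree
  is at most \<open>d * N\<close>. Irreducibility is the invariant of the whole construction: it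
  permits patterns to be planted, and it survives forced recurrence at the price of a larger
  adjacency. Freeness passes to subsets, so a free shift at the root is enough, and three symbols
  are what greedy colouring of a graph of degree two requires. Countably many stages suffice because
  density of orbits is tested on finitely many coordinates and on a countable family of open sets of
  \<open>X\<close>.\<close>

definition avoiding :: "'f set \<Rightarrow> ('f \<Rightarrow> 'v set) \<Rightarrow> ('f \<Rightarrow> 'v set set) \<Rightarrow> 'v set \<Rightarrow> 'v set set" where
  "avoiding F e Bad A = {w. w \<subseteq> A \<and> (\<forall>f\<in>F. e f \<subseteq> A \<longrightarrow> w \<inter> e f \<notin> Bad f)}"

lemma finite_avoiding: "finite A \<Longrightarrow> finite (avoiding F e Bad A)"
  unfolding avoiding_def by (rule finite_subset[of _ "Pow A"]) auto

text \<open>The vertices of \<open>A - C\<close> are added one at a time. Growth is assumed only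
  below \<open>card A\<close>, since this is what the induction hypothesis in
  \<open>avoiding_insert\<close> can supply.\<close>

lemma avoiding_iterate:
  fixes \<beta> :: real
  assumes step: "\<And>C v. C \<subseteq> A \<Longrightarrow> card C < card A \<Longrightarrow> v \<notin> C \<Longrightarrow>
      \<beta> * card (avoiding F e Bad C) \<le> card (avoiding F e Bad (insert v C))"
    and "finite A" "C \<subseteq> A" "0 \<le> \<beta>"
  shows "\<beta> ^ card (A - C) * card (avoiding F e Bad C) \<le> card (avoiding F e Bad A)"
proof -
  have "finite D \<Longrightarrow> D \<subseteq> A - C \<Longrightarrow>
      \<beta> ^ card D * card (avoiding F e Bad C) \<le> card (avoiding F e Bad (C \<union> D))" for D
  proof (induction D rule: finite_induct)
    case (insert v D)
    have "card (C \<union> D) < card A"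
      using insert.prems insert.hyps assms(2,3) by (intro psubset_card_mono) auto
    then have "\<beta> * card (avoiding F e Bad (C \<union> D)) \<le> card (avoiding F e Bad (insert v (C \<union> D)))"
      using insert.prems insert.hyps assms(3) by (intro step) auto
    moreover have "\<beta> * (\<beta> ^ card D * card (avoiding F e Bad C)) \<le> \<beta> * card (avoiding F e Bad (C \<union> D))"
      using insert assms(4) by (intro mult_left_mono) auto
    ultimately have "\<beta> * (\<beta> ^ card D * card (avoiding F e Bad C))
        \<le> card (avoiding F e Bad (insert v (C \<union> D)))" by linarith
    then show ?case using insert.hyps by (simp add: mult.assoc)
  qed auto
  from this[of "A - C"] show ?thesis using assms(2,3)
    by (simp add: Un_absorb1)
qed

text \<open>Rosenfeld's counting form of the local lemma: since every new vertex multiplies the number of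
  avoiding sets by at least \<open>\<beta>\<close>, the avoiding sets destroyed by one bad event on \<open>M\<close> vertices are
  outnumbered by a factor \<open>\<beta> ^ (M - 1)\<close>.\<close>

lemma avoiding_insert:
  fixes \<beta> :: real
  assumes F: "finite F" "\<And>f. f \<in> F \<Longrightarrow> finite (e f)" "\<And>f. f \<in> F \<Longrightarrow> card (e f) = M"
    and Bad: "\<And>f. f \<in> F \<Longrightarrow> Bad f \<subseteq> Pow (e f)" "\<And>f. f \<in> F \<Longrightarrow> card (Bad f) \<le> b"
    and deg: "\<And>v. card {f\<in>F. v \<in> e f} \<le> L"
    and \<beta>: "\<beta> > 0" "real L * real b \<le> (2 - \<beta>) * \<beta> ^ (M - 1)"
    and A: "finite A" "v \<notin> A"
  shows "\<beta> * card (avoiding F e Bad A) \<le> card (avoiding F e Bad (insert v A))"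
  using A
proof (induction "card A" arbitrary: A v rule: less_induct)
  case less
  let ?a = "avoiding F e Bad"
  define E where "E = {f\<in>F. v \<in> e f \<and> e f \<subseteq> insert v A}"
  define X where "X = ?a A \<union> insert v ` ?a A"
  \<comment> \<open>Extensions spoilt by \<open>f\<close>. Outside \<open>e f\<close> they still
    avoid all events, so they number at most \<open>b\<close> times the avoiding sets of
    \<open>A - e f\<close>.\<close>
  define Bd where "Bd f = {w. w \<subseteq> insert v A \<and> w \<inter> e f \<in> Bad f \<and> w - e f \<in> ?a (A - e f)}" for f
  have fa: "finite (?a C)" if "C \<subseteq> A" for C
    using that less.prems by (intro finite_avoiding) (auto intro: finite_subset)
  have finE: "finite E" unfolding E_def using F(1) by auto
  have sub: "w \<subseteq> A" if "w \<in> ?a A" for w using that by (auto simp: avoiding_def)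
  have cardX: "card X = 2 * card (?a A)"
  proof -
    have "card X = card (?a A) + card (insert v ` ?a A)"
      unfolding X_def using fa less.prems sub by (intro card_Un_disjoint) auto
    also have "card (insert v ` ?a A) = card (?a A)"
      using sub less.prems(2) by (intro card_image inj_onI) (metis insert_ident subsetD)
    finally show ?thesis by simp
  qed
  have finBd: "finite (Bd f)" for f
    unfolding Bd_def by (rule finite_subset[of _ "Pow (insert v A)"]) (use less.prems in auto)
  have X_A: "w - {v} \<in> ?a A \<and> w \<subseteq> insert v A" if wX: "w \<in> X" for w
  proof -
    obtain w' where w': "w' \<in> ?a A" "w = w' \<or> w = insert v w'" using wX by (auto simp: X_def)
    then have "w - {v} = w'" "w \<subseteq> insert v A" using sub[OF w'(1)] less.prems(2) by auto
    then show ?thesis using w' by simp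
  qed
  have incl: "X - (\<Union>f\<in>E. Bd f) \<subseteq> ?a (insert v A)"
  proof
    fix w assume w: "w \<in> X - (\<Union>f\<in>E. Bd f)"
    have wA: "w - {v} \<in> ?a A" "w \<subseteq> insert v A" using w X_A by auto
    have "w \<inter> e f \<notin> Bad f" if f: "f \<in> F" "e f \<subseteq> insert v A" for f
    proof (cases "v \<in> e f")
      case False
      then have "e f \<subseteq> A" "w \<inter> e f = (w - {v}) \<inter> e f" using f by auto
      then show ?thesis using wA f by (auto simp: avoiding_def)
    next
      case True
      then have "f \<in> E" using f by (auto simp: E_def)
      then have "w \<notin> Bd f" using w by auto
      moreover have "w - e f \<in> ?a (A - e f)"
      proof -
        have "(w - e f) \<inter> e f' \<notin> Bad f'" if f': "f' \<in> F" "e f' \<subseteq> A - e f" for f'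
        proof -
          have "(w - e f) \<inter> e f' = (w - {v}) \<inter> e f'" using f' True by auto
          then show ?thesis using wA(1) f' by (auto simp: avoiding_def)
        qed
        then show ?thesis using wA True by (auto simp: avoiding_def)
      qed
      ultimately show ?thesis using wA by (auto simp: Bd_def)
    qed
    then show "w \<in> ?a (insert v A)" using wA by (auto simp: avoiding_def)
  qed
  have cardBd: "\<beta> ^ (M - 1) * card (Bd f) \<le> real b * card (?a A)" if f: "f \<in> E" for f
  proof -
    have fF: "f \<in> F" "v \<in> e f" "e f \<subseteq> insert v A" using f by (auto simp: E_def)
    have finBad: "finite (Bad f)"
      using Bad(1)[OF fF(1)] F(2)[OF fF(1)] by (meson finite_Pow_iff finite_subset)
    have "card (Bd f) \<le> card (Bad f \<times> ?a (A - e f))"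
      by (rule card_inj_on_le[of "\<lambda>w. (w \<inter> e f, w - e f)"])
        (use finBad fa in \<open>auto simp: inj_on_def Bd_def\<close>)
    also have "\<dots> \<le> b * card (?a (A - e f))"
      using Bad(2)[OF fF(1)] by (simp add: card_cartesian_product)
    finally have 1: "card (Bd f) \<le> b * card (?a (A - e f))" .
    \<comment> \<open>The new vertex \<open>v\<close> lies in \<open>e f\<close> but not in
      \<open>A\<close>, so only \<open>M - 1\<close> vertices of \<open>A\<close> are lost; hence
      the exponent.\<close>
    have "A - (A - e f) = e f - {v}" using fF less.prems by auto
    then have "card (A - (A - e f)) = M - 1" using fF F(2,3)[OF fF(1)] by simp
    moreover have "\<beta> ^ card (A - (A - e f)) * card (?a (A - e f)) \<le> card (?a A)"
    proof (rule avoiding_iterate)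
      fix C u assume "C \<subseteq> A" "card C < card A" "u \<notin> C"
      then show "\<beta> * card (?a C) \<le> card (?a (insert u C))"
        using less.hyps less.prems(1) finite_subset by blast
    qed (use less.prems \<beta>(1) in auto)
    ultimately have 2: "\<beta> ^ (M - 1) * card (?a (A - e f)) \<le> card (?a A)" by simp
    have "\<beta> ^ (M - 1) * card (Bd f) \<le> \<beta> ^ (M - 1) * real (b * card (?a (A - e f)))"
      using 1 \<beta>(1) by (intro mult_left_mono) (simp_all only: of_nat_le_iff zero_le_power less_imp_le)
    also have "\<dots> = real b * (\<beta> ^ (M - 1) * card (?a (A - e f)))" by simp
    also have "\<dots> \<le> real b * card (?a A)" using 2 by (intro mult_left_mono) auto
    finally show ?thesis .
  qed
  have cE: "card E \<le> L"
    using deg[of v] card_mono[of "{f\<in>F. v \<in> e f}" E] F(1) by (force simp: E_def)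
  have "card X \<le> card (?a (insert v A) \<union> (\<Union>f\<in>E. Bd f))"
    using incl less.prems finE finBd by (intro card_mono) (auto intro: finite_avoiding)
  also have "\<dots> \<le> card (?a (insert v A)) + (\<Sum>f\<in>E. card (Bd f))"
    by (rule order_trans[OF card_Un_le]) (simp add: card_UN_le finE)
  finally have "2 * card (?a A) \<le> card (?a (insert v A)) + (\<Sum>f\<in>E. card (Bd f))"
    using cardX by simp
  then have "real (2 * card (?a A)) \<le> real (card (?a (insert v A)) + (\<Sum>f\<in>E. card (Bd f)))"
    by (simp only: of_nat_le_iff)
  then have main: "2 * real (card (?a A)) \<le> card (?a (insert v A)) + (\<Sum>f\<in>E. real (card (Bd f)))"
    by simp
  have "\<beta> ^ (M - 1) * (\<Sum>f\<in>E. real (card (Bd f))) \<le> (\<Sum>f\<in>E. real b * card (?a A))"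
    unfolding sum_distrib_left of_nat_sum using cardBd by (intro sum_mono) auto
  also have "\<dots> = real (card E) * (real b * card (?a A))" by simp
  also have "\<dots> \<le> L * (real b * card (?a A))" using cE by (intro mult_right_mono) auto
  also have "\<dots> = (real L * b) * card (?a A)" by simp
  also have "\<dots> \<le> (2 - \<beta>) * \<beta> ^ (M - 1) * card (?a A)" using \<beta>(2) by (intro mult_right_mono) auto
  finally have "\<beta> ^ (M - 1) * (\<Sum>f\<in>E. real (card (Bd f))) \<le> \<beta> ^ (M - 1) * ((2 - \<beta>) * card (?a A))"
    by (simp add: mult_ac)
  then have "(\<Sum>f\<in>E. real (card (Bd f))) \<le> (2 - \<beta>) * card (?a A)"
    using \<beta>(1) by (simp add: mult_le_cancel_left_pos)
  then show ?case using main by (simp add: algebra_simps)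
qed

lemma avoiding_nonempty:
  fixes \<beta> :: real
  assumes F: "finite F" "\<And>f. f \<in> F \<Longrightarrow> finite (e f)" "\<And>f. f \<in> F \<Longrightarrow> card (e f) = M" "M > 0"
    and Bad: "\<And>f. f \<in> F \<Longrightarrow> Bad f \<subseteq> Pow (e f)" "\<And>f. f \<in> F \<Longrightarrow> card (Bad f) \<le> b"
    and deg: "\<And>v. card {f\<in>F. v \<in> e f} \<le> L"
    and \<beta>: "\<beta> > 0" "real L * real b \<le> (2 - \<beta>) * \<beta> ^ (M - 1)"
  shows "\<exists>w. \<forall>f\<in>F. w \<inter> e f \<notin> Bad f"
proof -
  have pos: "card (avoiding F e Bad A) > 0" if "finite A" for A
    using that
  proof (induction A rule: finite_induct)
    case empty
    \<comment> \<open>\<open>M > 0\<close> makes every event inactive on the empty vertex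
      set.\<close>
    have "{} \<in> avoiding F e Bad {}" using F(3,4) by (force simp: avoiding_def)
    then show ?case using finite_avoiding[of "{}" F e Bad] by (auto simp: card_gt_0_iff)
  next
    case (insert v A)
    have "0 < \<beta> * card (avoiding F e Bad A)" using insert \<beta>(1) by simp
    also have "\<dots> \<le> card (avoiding F e Bad (insert v A))"
      using F(1-3) Bad deg \<beta> insert.hyps by (rule avoiding_insert)
    finally show ?case by simp
  qed
  have "avoiding F e Bad (\<Union>f\<in>F. e f) \<noteq> {}" using pos[of "\<Union>f\<in>F. e f"] F(1,2) by force
  then show ?thesis unfolding avoiding_def by blast
qed

text \<open>\<open>d * N\<close> will be both the size of an event and the bound on the degree;
  \<open>(2^d - 1)^N\<close> bounds the number of bad patterns, since one of the \<open>2^d\<close>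
  patterns is ruled out on each of \<open>N\<close> cells. For \<beta> < 2 close to 2 the ratio
  \<open>(2^d - 1) / \<beta>^d\<close> is below 1, and its powers beat the linear degree.\<close>

lemma local_lemma_constants:
  assumes "d > 0"
  shows "\<exists>\<beta>>0::real. \<exists>N>0. real (d * N) * real ((2^d - 1)^N) \<le> (2 - \<beta>) * \<beta> ^ (d * N - 1)"
proof -
  have "((\<lambda>t. t ^ d) \<longlongrightarrow> (2::real) ^ d) (at_left 2)"
    by (intro tendsto_intros)
  then have "eventually (\<lambda>t::real. t ^ d > 2 ^ d - 1) (at_left 2)"
    by (rule order_tendstoD) simp
  moreover have "eventually (\<lambda>t::real. t \<in> {1<..<2}) (at_left 2)"
    by (rule eventually_at_left_real) simp
  ultimately obtain \<beta> :: real where \<beta>: "\<beta> ^ d > 2 ^ d - 1" "1 < \<beta>" "\<beta> < 2"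
    using eventually_happens'[OF trivial_limit_at_left_real eventually_conj] by fastforce
  define r where "r = (2 ^ d - 1) / \<beta> ^ d"
  have r: "0 \<le> r" "r < 1" using \<beta> by (auto simp: r_def)
  have "(\<lambda>n. real n * r ^ n) \<longlonglongrightarrow> 0"
    using r by (intro powser_times_n_limit_0) auto
  then have "(\<lambda>n. real d * (real n * r ^ n)) \<longlonglongrightarrow> real d * 0" by (intro tendsto_intros)
  \<comment> \<open>The target \<open>(2 - \<beta>) / \<beta>\<close> pays for the exponent
    \<open>d * N - 1\<close> in place of \<open>d * N\<close>.\<close>
  then have "eventually (\<lambda>n. real d * (real n * r ^ n) < (2 - \<beta>) / \<beta>) sequentially"
    by (rule order_tendstoD) (use \<beta> in auto)
  then have "eventually (\<lambda>n. real d * (real n * r ^ n) < (2 - \<beta>) / \<beta> \<and> n > 0) sequentially"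
    using eventually_gt_at_top eventually_conj by blast
  then obtain N where N: "real d * (real N * r ^ N) < (2 - \<beta>) / \<beta>" "N > 0"
    using eventually_happens'[OF sequentially_bot] by blast
  have "real d * (real N * r ^ N) * \<beta> ^ (d * N) \<le> (2 - \<beta>) / \<beta> * \<beta> ^ (d * N)"
    using N \<beta> by (intro mult_right_mono) auto
  moreover have "r ^ N * \<beta> ^ (d * N) = (2 ^ d - 1) ^ N"
    using \<beta> by (simp add: r_def power_divide power_mult)
  moreover have "(2 - \<beta>) / \<beta> * \<beta> ^ (d * N) = (2 - \<beta>) * \<beta> ^ (d * N - 1)"
    using \<beta> N(2) assms by (simp add: power_diff)
  moreover have "real ((2 ^ d - 1) ^ N) = (2 ^ d - 1) ^ N" by (simp add: of_nat_diff)
  ultimately have "real (d * N) * real ((2^d - 1)^N) \<le> (2 - \<beta>) * \<beta> ^ (d * N - 1)"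
    by (simp add: mult.assoc)
  then show ?thesis using N(2) \<beta> by (intro exI[of _ \<beta>]) auto
qed

text \<open>The point is that \<open>N\<close> depends on \<open>D\<close> only and not on \<open>F\<close>: two sets \<open>D B f\<close>, \<open>D B f'\<close> meet for
  boundedly many \<open>f'\<close>, whatever \<open>F\<close> is. The set \<open>S\<close> consists of the isolated points of a set that
  has a point isolated in its \<open>D\<close>-neighbourhood on every \<open>B f\<close>.\<close>

lemma (in group) separated_hitting_set:
  assumes D: "finite D" "D \<subseteq> carrier G" "\<one> \<in> D"
  shows "\<exists>N. \<forall>B F. B \<subseteq> carrier G \<longrightarrow> card B = N \<longrightarrow>
      (\<forall>b\<in>B. \<forall>b'\<in>B. \<forall>\<delta>\<in>D. \<forall>\<delta>'\<in>D. \<delta> \<otimes> b = \<delta>' \<otimes> b' \<longrightarrow> b = b') \<longrightarrow>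
      finite F \<longrightarrow> F \<subseteq> carrier G \<longrightarrow>
      (\<exists>S. finite S \<and> S \<subseteq> carrier G \<and> (\<forall>f\<in>F. \<exists>b\<in>B. b \<otimes> f \<in> S) \<and>
        (\<forall>s\<in>S. \<forall>\<delta>\<in>D. \<delta> \<otimes> s \<in> S \<longrightarrow> \<delta> = \<one>))"
proof -
  define d where "d = card D"
  have d: "d > 0" using D by (auto simp: d_def card_gt_0_iff)
  obtain \<beta> :: real and N where \<beta>: "\<beta> > 0" "N > 0"
    "real (d * N) * real ((2^d - 1)^N) \<le> (2 - \<beta>) * \<beta> ^ (d * N - 1)"
    using local_lemma_constants[OF d] by blast
  show ?thesis
  proof (rule exI[of _ N], intro allI impI)
    fix B F
    assume B: "B \<subseteq> carrier G" "card B = N"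
      and sep: "\<forall>b\<in>B. \<forall>b'\<in>B. \<forall>\<delta>\<in>D. \<forall>\<delta>'\<in>D. \<delta> \<otimes> b = \<delta>' \<otimes> b' \<longrightarrow> b = b'"
      and F: "finite F" "F \<subseteq> carrier G"
    have finB: "finite B" using B \<beta>(2) by (metis card.infinite less_irrefl)
    \<comment> \<open>\<open>cell f b\<close> is the \<open>D\<close>-neighbourhood of the point
      \<open>b \<otimes> f\<close>; separation of \<open>B\<close> makes the cells of one
      \<open>f\<close> disjoint. The event is bad if none of these points is the only point of
      \<open>w\<close> in its cell.\<close>
    define cell where "cell f b = (\<lambda>\<delta>. \<delta> \<otimes> (b \<otimes> f)) ` D" for f b
    define e where "e f = (\<Union>b\<in>B. cell f b)" for f
    define Bad where "Bad f = {w \<in> Pow (e f). \<forall>b\<in>B. w \<inter> cell f b \<noteq> {b \<otimes> f}}" for f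
    have car: "b \<in> carrier G" "\<delta> \<in> carrier G" "f \<in> carrier G" if "b \<in> B" "\<delta> \<in> D" "f \<in> F" for b \<delta> f
      using that B D F by auto
    have fin_cell: "finite (cell f b)" for f b using D by (simp add: cell_def)
    have fin_e: "finite (e f)" for f using finB fin_cell by (simp add: e_def)
    have card_cell: "card (cell f b) = d" if "f \<in> F" "b \<in> B" for f b
    proof -
      have "inj_on (\<lambda>\<delta>. \<delta> \<otimes> (b \<otimes> f)) D"
        using that B D F by (intro inj_onI) (auto simp: subset_iff)
      then show ?thesis by (simp add: cell_def card_image d_def)
    qed
    have cell_disj: "b = b'" if h: "f \<in> F" "b \<in> B" "b' \<in> B" "x \<in> cell f b" "x \<in> cell f b'" for f b b' x
    proof -
      obtain \<delta> \<delta>' where \<delta>: "\<delta> \<in> D" "\<delta>' \<in> D" "\<delta> \<otimes> (b \<otimes> f) = \<delta>' \<otimes> (b' \<otimes> f)"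
        using h(4,5) by (auto simp: cell_def)
      then have "(\<delta> \<otimes> b) \<otimes> f = (\<delta>' \<otimes> b') \<otimes> f"
        using car[OF h(2) \<delta>(1) h(1)] car[OF h(3) \<delta>(2) h(1)] by (simp add: m_assoc)
      then have "\<delta> \<otimes> b = \<delta>' \<otimes> b'"
        using car[OF h(2) \<delta>(1) h(1)] car[OF h(3) \<delta>(2) h(1)] by simp
      then show ?thesis using sep h \<delta> by blast
    qed
    have card_e: "card (e f) = d * N" if "f \<in> F" for f
    proof -
      have "card (e f) = (\<Sum>b\<in>B. card (cell f b))"
        unfolding e_def using finB fin_cell cell_disj[OF that] by (intro card_UN_disjoint) auto
      then show ?thesis using card_cell[OF that] B by simp
    qed
    have card_Bad: "card (Bad f) \<le> (2^d - 1)^N" if f: "f \<in> F" for f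
    proof -
      have "inj_on (\<lambda>w. \<lambda>b\<in>B. w \<inter> cell f b) (Bad f)"
      proof (rule inj_onI)
        fix w w' assume w: "w \<in> Bad f" "w' \<in> Bad f"
          and eq: "(\<lambda>b\<in>B. w \<inter> cell f b) = (\<lambda>b\<in>B. w' \<inter> cell f b)"
        have eq': "w \<inter> cell f b = w' \<inter> cell f b" if "b \<in> B" for b
          using fun_cong[OF eq, of b] that by simp
        have "w = (\<Union>b\<in>B. w \<inter> cell f b)" using w by (auto simp: Bad_def e_def)
        also have "\<dots> = (\<Union>b\<in>B. w' \<inter> cell f b)" using eq' by (intro SUP_cong refl) auto
        also have "\<dots> = w'" using w by (auto simp: Bad_def e_def)
        finally show "w = w'" .
      qed
      moreover have "(\<lambda>w. \<lambda>b\<in>B. w \<inter> cell f b) ` Bad f \<subseteq> (\<Pi>\<^sub>E b\<in>B. Pow (cell f b) - {{b \<otimes> f}})"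
        by (auto simp: Bad_def)
      ultimately have "card (Bad f) \<le> card (\<Pi>\<^sub>E b\<in>B. Pow (cell f b) - {{b \<otimes> f}})"
        using finB fin_cell by (intro card_inj_on_le) (auto intro!: finite_PiE)
      also have "\<dots> = (\<Prod>b\<in>B. card (Pow (cell f b) - {{b \<otimes> f}}))"
        using finB by (rule card_PiE)
      also have "\<dots> = (\<Prod>b\<in>B. 2^d - 1)"
      proof (intro prod.cong refl)
        fix b assume b: "b \<in> B"
        have "b \<otimes> f \<in> cell f b" unfolding cell_def
          using car[OF b D(3) f] D(3) by (intro image_eqI[of _ _ \<one>]) auto
        then show "card (Pow (cell f b) - {{b \<otimes> f}}) = 2^d - 1"
          using fin_cell by (simp add: card_Pow card_cell[OF f b])
      qed
      finally show ?thesis using B by simp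
    qed
    have deg: "card {f\<in>F. v \<in> e f} \<le> d * N" for v
    proof -
      \<comment> \<open>A vertex \<open>v = \<delta> \<otimes> (b \<otimes> f)\<close> and the pair
        \<open>(\<delta>, b)\<close> determine \<open>f\<close>, which bounds the degree
        independently of \<open>F\<close>.\<close>
      have "{f\<in>F. v \<in> e f} \<subseteq> (\<lambda>(\<delta>, b). inv (\<delta> \<otimes> b) \<otimes> v) ` (D \<times> B)"
      proof
        fix f assume "f \<in> {f\<in>F. v \<in> e f}"
        then obtain \<delta> b where *: "f \<in> F" "\<delta> \<in> D" "b \<in> B" "v = \<delta> \<otimes> (b \<otimes> f)"
          by (auto simp: e_def cell_def)
        then have "f = inv (\<delta> \<otimes> b) \<otimes> v"
          using car[OF *(3,2,1)] by (simp add: inv_solve_left m_assoc)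
        then show "f \<in> (\<lambda>(\<delta>, b). inv (\<delta> \<otimes> b) \<otimes> v) ` (D \<times> B)" using * by force
      qed
      then have "card {f\<in>F. v \<in> e f} \<le> card (D \<times> B)"
        using D finB by (intro surj_card_le) auto
      then show ?thesis using B by (simp add: card_cartesian_product d_def)
    qed
    have "\<exists>w. \<forall>f\<in>F. w \<inter> e f \<notin> Bad f"
      by (rule avoiding_nonempty[OF F(1) fin_e card_e _ _ card_Bad deg \<beta>(1,3)])
        (use d \<beta>(2) in \<open>auto simp: Bad_def\<close>)
    then obtain w where w: "\<And>f. f \<in> F \<Longrightarrow> w \<inter> e f \<notin> Bad f" by blast
    define S where "S = {s \<in> (\<lambda>(b, f). b \<otimes> f) ` (B \<times> F). w \<inter> (\<lambda>\<delta>. \<delta> \<otimes> s) ` D = {s}}"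
    have "finite S" "S \<subseteq> carrier G" using finB F B by (auto simp: S_def)
    moreover have "\<exists>b\<in>B. b \<otimes> f \<in> S" if f: "f \<in> F" for f
    proof -
      obtain b where b: "b \<in> B" "w \<inter> e f \<inter> cell f b = {b \<otimes> f}"
        using w[OF f] by (auto simp: Bad_def)
      then have "w \<inter> cell f b = {b \<otimes> f}" by (auto simp: e_def)
      then have "b \<otimes> f \<in> S" using b f by (auto simp: S_def cell_def)
      then show ?thesis using b by blast
    qed
    moreover have "\<delta> = \<one>" if "s \<in> S" "\<delta> \<in> D" "\<delta> \<otimes> s \<in> S" for s \<delta>
    proof -
      have "\<delta> \<otimes> s \<in> w" using that(3) by (auto simp: S_def)
      then have "\<delta> \<otimes> s \<in> w \<inter> (\<lambda>\<delta>. \<delta> \<otimes> s) ` D" using that(2) by blast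
      then have "\<delta> \<otimes> s = s" using that(1) by (auto simp: S_def)
      moreover have "\<delta> \<in> carrier G" "s \<in> carrier G" using \<open>S \<subseteq> carrier G\<close> that D(2) by auto
      ultimately show ?thesis by simp
    qed
    ultimately show "\<exists>S. finite S \<and> S \<subseteq> carrier G \<and> (\<forall>f\<in>F. \<exists>b\<in>B. b \<otimes> f \<in> S) \<and>
        (\<forall>s\<in>S. \<forall>\<delta>\<in>D. \<delta> \<otimes> s \<in> S \<longrightarrow> \<delta> = \<one>)" by blast
  qed
qed

section \<open>Irreducible shifts\<close>

lemma closed_coordinate_eq: "closed {y :: nat \<Rightarrow> real. y i = r}"
  by (intro closed_Collect_eq continuous_on_product_coordinates continuous_intros)

lemma compact_ternary_sequences: "compact {y :: nat \<Rightarrow> real. \<forall>i. y i \<in> {0,1,2}}"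
proof -
  have "{y :: nat \<Rightarrow> real. \<forall>i. y i \<in> {0,1,2}} = (\<Pi>\<^sub>E i\<in>UNIV. {0,1,2})" by auto
  moreover have "compactin (product_topology (\<lambda>i::nat. euclidean) UNIV) (\<Pi>\<^sub>E i\<in>UNIV. {0,1,2::real})"
    by (subst compactin_PiE) (auto intro!: finite_imp_compact)
  ultimately show ?thesis by (simp add: euclidean_product_topology)
qed

lemma maximal_independent_set:
  assumes sym: "\<And>a b. R a b \<Longrightarrow> R b a"
  shows "\<exists>P\<subseteq>A. (\<forall>a\<in>P. \<forall>b\<in>P. R a b \<longrightarrow> a = b) \<and> (\<forall>a\<in>A. a \<in> P \<or> (\<exists>p\<in>P. R p a))"
proof -
  let ?C = "{P. P \<subseteq> A \<and> (\<forall>a\<in>P. \<forall>b\<in>P. R a b \<longrightarrow> a = b)}"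
  have "\<exists>M\<in>?C. \<forall>X\<in>?C. M \<subseteq> X \<longrightarrow> X = M"
  proof (rule subset_Zorn_nonempty)
    fix \<C> assume ch: "\<C> \<noteq> {}" "subset.chain ?C \<C>"
    have "a = b" if "R a b" "a \<in> X" "X \<in> \<C>" "b \<in> Z" "Z \<in> \<C>" for a b X Z
    proof -
      have "X \<subseteq> Z \<or> Z \<subseteq> X" "X \<in> ?C" "Z \<in> ?C"
        using ch(2) that by (auto simp: subset_chain_def)
      then show ?thesis using that by blast
    qed
    moreover have "\<Union>\<C> \<subseteq> A" using ch(2) by (auto simp: subset_chain_def)
    ultimately show "\<Union>\<C> \<in> ?C" by blast
  qed blast
  then obtain P where "P \<in> ?C" and max: "\<forall>X\<in>?C. P \<subseteq> X \<longrightarrow> X = P" ..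
  then have P: "P \<subseteq> A" "\<forall>a\<in>P. \<forall>b\<in>P. R a b \<longrightarrow> a = b" by simp_all
  have "a \<in> P \<or> (\<exists>p\<in>P. R p a)" if "a \<in> A" for a
  proof (rule ccontr)
    assume a: "\<not> (a \<in> P \<or> (\<exists>p\<in>P. R p a))"
    then have "insert a P \<in> ?C" using P that sym by auto
    with max have "P \<subseteq> insert a P \<longrightarrow> insert a P = P" by (rule bspec)
    then show False using a by auto
  qed
  then show ?thesis using P by (intro exI[of _ P] conjI ballI) auto
qed

text \<open>Two neighbours always leave one of three colours free, so colours can be chosen along
  \<open>nat\<close> outside \<open>E\<close>. This becomes the gluing property of the shift of
  proper colourings.\<close>

lemma greedy_three_colouring:
  fixes nb :: "nat \<Rightarrow> nat set" and p :: "nat \<Rightarrow> real"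
  assumes nb: "\<And>i. finite (nb i)" "\<And>i. card (nb i) \<le> 2" "\<And>i j. j \<in> nb i \<Longrightarrow> i \<in> nb j"
      "\<And>i. i \<notin> nb i"
    and p: "\<And>i. i \<in> E \<Longrightarrow> p i \<in> {0,1,2}" "\<And>i j. i \<in> E \<Longrightarrow> j \<in> E \<Longrightarrow> j \<in> nb i \<Longrightarrow> p i \<noteq> p j"
  shows "\<exists>f. (\<forall>i. f i \<in> {0,1,2}) \<and> (\<forall>i\<in>E. f i = p i) \<and> (\<forall>i. \<forall>j\<in>nb i. f i \<noteq> f j)"
proof -
  \<comment> \<open>A vertex outside \<open>E\<close> is compared with prescribed neighbours and
    with earlier ones only; symmetry of \<open>nb\<close> then covers every edge.\<close>
  define P where "P f i r \<longleftrightarrow> r \<in> {0,1,2} \<and> (i \<in> E \<longrightarrow> r = p i) \<and>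
    (i \<notin> E \<longrightarrow> (\<forall>j\<in>nb i. (j \<in> E \<longrightarrow> r \<noteq> p j) \<and> (j \<notin> E \<and> j < i \<longrightarrow> r \<noteq> f j)))"
    for f :: "nat \<Rightarrow> real" and i r
  have "\<exists>f. \<forall>i. P f i (f i)"
  proof (rule dependent_wf_choice[OF wf_less_than])
    fix f :: "nat \<Rightarrow> real" and i
    show "\<exists>r. P f i r"
    proof (cases "i \<in> E")
      case True
      then show ?thesis using p by (auto simp: P_def)
    next
      case False
      \<comment> \<open>Later neighbours outside \<open>E\<close>, whose value is still arbitrary,
        are counted too; the bound two covers them as well.\<close>
      define used where "used = (\<lambda>j. if j \<in> E then p j else f j) ` nb i"
      have "card used \<le> 2" unfolding used_def using nb(1,2) card_image_le order_trans by blast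
      moreover have "finite used" using nb(1) by (simp add: used_def)
      ultimately have "\<not> {0,1,2::real} \<subseteq> used" using card_mono[of used "{0,1,2::real}"] by auto
      then obtain r where "r \<in> {0,1,2}" "r \<notin> used" by blast
      then show ?thesis using False by (intro exI[of _ r]) (force simp: P_def used_def)
    qed
  qed (auto simp: P_def)
  then obtain f where f: "\<And>i. P f i (f i)" by blast
  have E: "f i = p i" if "i \<in> E" for i using f[of i] that by (simp add: P_def)
  have "f i \<noteq> f j" if ij: "j \<in> nb i" for i j
  proof (cases "i \<in> E"; cases "j \<in> E")
    assume "i \<in> E" "j \<in> E" then show ?thesis using E p(2) ij by simp
  next
    assume "i \<in> E" "j \<notin> E" then show ?thesis using E f[of j] nb(3)[OF ij] by (auto simp: P_def)
  next
    assume "i \<notin> E" "j \<in> E" then show ?thesis using E f[of i] ij by (auto simp: P_def)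
  next
    assume "i \<notin> E" "j \<notin> E"
    moreover have "i \<noteq> j" using nb(4) ij by auto
    ultimately show ?thesis using f[of i] f[of j] ij nb(3)[OF ij]
      by (cases "i < j") (auto simp: P_def)
  qed
  moreover have "f i \<in> {0,1,2}" for i using f[of i] by (simp add: P_def)
  ultimately show ?thesis using E by blast
qed

text \<open>A free right action on the coordinates, so that precomposition is a left action on
  configurations of type \<open>nat \<Rightarrow> real\<close>. Several orbits are allowed: the
  instance constructed later has infinitely many.\<close>

locale index_action = group G for G (structure) +
  fixes \<sigma> :: "'a \<Rightarrow> nat \<Rightarrow> nat"
  assumes \<sigma>_one: "\<sigma> \<one> i = i"
    and \<sigma>_mult: "\<lbrakk>g \<in> carrier G; h \<in> carrier G\<rbrakk> \<Longrightarrow> \<sigma> (g \<otimes> h) i = \<sigma> h (\<sigma> g i)"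
    and \<sigma>_free: "\<lbrakk>g \<in> carrier G; h \<in> carrier G; \<sigma> g i = \<sigma> h i\<rbrakk> \<Longrightarrow> g = h"
begin

definition act :: "'a \<Rightarrow> (nat \<Rightarrow> real) \<Rightarrow> nat \<Rightarrow> real" where
  "act g y = (\<lambda>i. y (\<sigma> g i))"

definition local_rel :: "(nat \<Rightarrow> nat \<Rightarrow> bool) \<Rightarrow> bool" where
  "local_rel adj \<longleftrightarrow> (\<forall>i. adj i i) \<and> (\<forall>i j. adj i j \<longrightarrow> adj j i) \<and>
     (\<forall>g\<in>carrier G. \<forall>i j. adj i j \<longrightarrow> adj (\<sigma> g i) (\<sigma> g j)) \<and> (\<forall>i. finite {j. adj i j})"

text \<open>The function \<open>c\<close> tells each point of \<open>E\<close> from which configuration its symbol is copied;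
  adjacent points have to copy from the same one. With \<open>E = {}\<close> this includes \<open>Y \<noteq> {}\<close>.\<close>

definition glues :: "(nat \<Rightarrow> nat \<Rightarrow> bool) \<Rightarrow> (nat \<Rightarrow> real) set \<Rightarrow> bool" where
  "glues adj Y \<longleftrightarrow> (\<forall>E c. (\<forall>i\<in>E. c i \<in> Y) \<and> (\<forall>i\<in>E. \<forall>j\<in>E. adj i j \<longrightarrow> c i = c j)
     \<longrightarrow> (\<exists>x\<in>Y. \<forall>i\<in>E. x i = c i i))"

definition irreducible_shift :: "(nat \<Rightarrow> real) set \<Rightarrow> bool" where
  "irreducible_shift Y \<longleftrightarrow> closed Y \<and> (\<forall>y\<in>Y. \<forall>i. y i \<in> {0,1,2}) \<and>
     (\<forall>g\<in>carrier G. \<forall>y\<in>Y. act g y \<in> Y) \<and> (\<exists>adj. local_rel adj \<and> glues adj Y)"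

lemma act_one [simp]: "act \<one> y = y"
  by (simp add: act_def \<sigma>_one)

lemma act_mult: "\<lbrakk>g \<in> carrier G; h \<in> carrier G\<rbrakk> \<Longrightarrow> act (g \<otimes> h) y = act g (act h y)"
  by (simp add: act_def \<sigma>_mult)

lemma \<sigma>_inv: "g \<in> carrier G \<Longrightarrow> \<sigma> (inv g) (\<sigma> g i) = i"
  using \<sigma>_mult[of g "inv g" i] by (simp add: \<sigma>_one)

lemma \<sigma>_inv': "g \<in> carrier G \<Longrightarrow> \<sigma> g (\<sigma> (inv g) i) = i"
  using \<sigma>_mult[of "inv g" g i] by (simp add: \<sigma>_one)

lemma glues_nonempty: "glues adj Y \<Longrightarrow> Y \<noteq> {}"
  unfolding glues_def by (drule spec[of _ "{}"]) auto

lemma irreducible_shift_nonempty: "irreducible_shift Y \<Longrightarrow> Y \<noteq> {}"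
  unfolding irreducible_shift_def using glues_nonempty by blast

lemma finite_transporter: "finite {q\<in>carrier G. \<sigma> q i = j}"
proof (cases "\<exists>q\<in>carrier G. \<sigma> q i = j")
  case True
  then obtain q where "q \<in> carrier G" "\<sigma> q i = j" by blast
  then have "{q\<in>carrier G. \<sigma> q i = j} \<subseteq> {q}" using \<sigma>_free by auto
  then show ?thesis by (rule finite_subset) simp
next
  case False
  then have "{q\<in>carrier G. \<sigma> q i = j} = {}" by blast
  then show ?thesis by (simp only: finite.emptyI)
qed

text \<open>The window at \<open>q\<close> is the set of all \<open>\<sigma> q t\<close> with
  \<open>t \<in> T\<close>. The clause \<open>q = g\<close> keeps the relation reflexive when
  \<open>T\<close> is empty.\<close>

definition near :: "(nat \<Rightarrow> nat \<Rightarrow> bool) \<Rightarrow> nat set \<Rightarrow> 'a \<Rightarrow> 'a \<Rightarrow> bool" where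
  "near adj T q g \<longleftrightarrow> q = g \<or> (\<exists>t\<in>T. \<exists>t'\<in>T. adj (\<sigma> q t) (\<sigma> g t'))"

definition occurs :: "(nat \<Rightarrow> real) \<Rightarrow> nat set \<Rightarrow> (nat \<Rightarrow> real) \<Rightarrow> 'a \<Rightarrow> bool" where
  "occurs w T y q \<longleftrightarrow> (\<forall>t\<in>T. y (\<sigma> q t) = w t)"

text \<open>The gap allowed between occurrences is adjacency of windows. This makes the condition
  inheritable under gluing: a window that touches glued material is adjacent to an occurrence in it,
  and the other windows are served by a maximal non-adjacent family of new occurrences.\<close>

definition recurrent_part where
  "recurrent_part adj w T Y =
     {y\<in>Y. \<forall>g\<in>carrier G. \<exists>q\<in>carrier G. near adj T q g \<and> occurs w T y q}"

section \<open>Gluing after recurrence has been forced\<close>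

context
  fixes adj :: "nat \<Rightarrow> nat \<Rightarrow> bool"
  assumes adj: "local_rel adj"
begin

lemma adj_refl: "adj i i"
  and adj_sym: "adj i j \<Longrightarrow> adj j i"
  and adj_inv: "g \<in> carrier G \<Longrightarrow> adj i j \<Longrightarrow> adj (\<sigma> g i) (\<sigma> g j)"
  and adj_finite: "finite {j. adj i j}"
  using adj by (auto simp: local_rel_def)

lemma near_sym: "near adj T q g \<Longrightarrow> near adj T g q"
  unfolding near_def using adj_sym by blast

lemma near_mult:
  "\<lbrakk>q \<in> carrier G; g \<in> carrier G; h \<in> carrier G; near adj T q g\<rbrakk> \<Longrightarrow> near adj T (q \<otimes> h) (g \<otimes> h)"
  unfolding near_def by (auto simp: \<sigma>_mult intro: adj_inv)

lemma finite_near: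
  assumes "finite T"
  shows "finite {q\<in>carrier G. near adj T q g}"
proof (rule finite_subset)
  show "{q\<in>carrier G. near adj T q g} \<subseteq>
      insert g (\<Union>t\<in>T. \<Union>t'\<in>T. \<Union>j\<in>{j. adj (\<sigma> g t') j}. {q\<in>carrier G. \<sigma> q t = j})"
    unfolding near_def using adj_sym by blast
  show "finite (insert g (\<Union>t\<in>T. \<Union>t'\<in>T. \<Union>j\<in>{j. adj (\<sigma> g t') j}. {q\<in>carrier G. \<sigma> q t = j}))"
    using assms adj_finite finite_transporter by simp
qed

text \<open>All coordinates that may have to be preserved along with \<open>i\<close>: if a window
  touches \<open>i\<close>, the occurrence serving it lies in a window near that one.\<close>

definition reach :: "nat set \<Rightarrow> nat \<Rightarrow> nat set" where
  "reach T i = insert i {\<sigma> q t | q g t t'. q \<in> carrier G \<and> g \<in> carrier G \<and> t \<in> T \<and> t' \<in> T \<and>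
      near adj T q g \<and> adj i (\<sigma> g t')}"

text \<open>The enlarged adjacency: two points must copy from the same configuration as soon as the
  regions preserved around them touch.\<close>

definition wide :: "nat set \<Rightarrow> nat \<Rightarrow> nat \<Rightarrow> bool" where
  "wide T i j \<longleftrightarrow> (\<exists>a\<in>reach T i. \<exists>b\<in>reach T j. adj a b)"

lemma reach_inv:
  assumes "h \<in> carrier G" "a \<in> reach T i"
  shows "\<sigma> h a \<in> reach T (\<sigma> h i)"
proof (cases "a = i")
  case False
  then obtain q g t t' where *: "q \<in> carrier G" "g \<in> carrier G" "t \<in> T" "t' \<in> T" "near adj T q g"
      "adj i (\<sigma> g t')" "a = \<sigma> q t"
    using assms(2) unfolding reach_def by blast
  have "\<sigma> h a = \<sigma> (q \<otimes> h) t" "adj (\<sigma> h i) (\<sigma> (g \<otimes> h) t')" "near adj T (q \<otimes> h) (g \<otimes> h)"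
    using * assms(1) by (auto simp: \<sigma>_mult intro: adj_inv near_mult)
  then show ?thesis unfolding reach_def using * assms(1) m_closed by blast
qed (simp add: reach_def)

lemma finite_reach:
  assumes "finite T"
  shows "finite (reach T i)"
proof (rule finite_subset)
  show "reach T i \<subseteq> insert i (\<Union>t\<in>T. \<Union>t'\<in>T. \<Union>j\<in>{j. adj i j}. \<Union>g\<in>{g\<in>carrier G. \<sigma> g t' = j}.
      \<Union>q\<in>{q\<in>carrier G. near adj T q g}. {\<sigma> q t})"
    unfolding reach_def by blast
  show "finite (insert i (\<Union>t\<in>T. \<Union>t'\<in>T. \<Union>j\<in>{j. adj i j}. \<Union>g\<in>{g\<in>carrier G. \<sigma> g t' = j}.
      \<Union>q\<in>{q\<in>carrier G. near adj T q g}. {\<sigma> q t}))"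
    using assms adj_finite finite_transporter finite_near[OF assms] by simp
qed

text \<open>Local finiteness of \<open>wide\<close> also runs backwards through
  \<open>reach\<close>, from a point to all \<open>j\<close> whose reach contains it.\<close>

lemma finite_reach_converse:
  assumes "finite T"
  shows "finite {i. a \<in> reach T i}"
proof (rule finite_subset)
  show "{i. a \<in> reach T i} \<subseteq> insert a (\<Union>t\<in>T. \<Union>t'\<in>T. \<Union>q\<in>{q\<in>carrier G. \<sigma> q t = a}.
      \<Union>g\<in>{g\<in>carrier G. near adj T g q}. {i. adj (\<sigma> g t') i})" (is "_ \<subseteq> insert a ?B")
  proof
    fix i assume "i \<in> {i. a \<in> reach T i}"
    then consider "i = a" | q g t t' where "q \<in> carrier G" "g \<in> carrier G" "t \<in> T" "t' \<in> T"
        "near adj T q g" "adj i (\<sigma> g t')" "a = \<sigma> q t"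
      unfolding reach_def by blast
    then show "i \<in> insert a ?B"
    proof cases
      case (2 q g t t')
      then have "near adj T g q" "adj (\<sigma> g t') i" by (auto intro: near_sym adj_sym)
      then have "i \<in> ?B" using 2 by blast
      then show ?thesis by (rule insertI2)
    qed simp
  qed
  show "finite (insert a (\<Union>t\<in>T. \<Union>t'\<in>T. \<Union>q\<in>{q\<in>carrier G. \<sigma> q t = a}.
      \<Union>g\<in>{g\<in>carrier G. near adj T g q}. {i. adj (\<sigma> g t') i}))"
    using assms adj_finite finite_transporter finite_near[OF assms] by simp
qed

lemma local_rel_wide:
  assumes "finite T"
  shows "local_rel (wide T)"
  unfolding local_rel_def
proof (intro conjI allI ballI impI)
  fix i show "wide T i i" unfolding wide_def reach_def using adj_refl by blast
  show "finite {j. wide T i j}"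
  proof (rule finite_subset)
    show "{j. wide T i j} \<subseteq> (\<Union>a\<in>reach T i. \<Union>b\<in>{b. adj a b}. {j. b \<in> reach T j})"
      unfolding wide_def by blast
    show "finite (\<Union>a\<in>reach T i. \<Union>b\<in>{b. adj a b}. {j. b \<in> reach T j})"
      using finite_reach[OF assms] finite_reach_converse[OF assms] adj_finite by simp
  qed
next
  fix i j assume "wide T i j" then show "wide T j i" unfolding wide_def using adj_sym by blast
next
  fix g i j assume "g \<in> carrier G" "wide T i j"
  then show "wide T (\<sigma> g i) (\<sigma> g j)" unfolding wide_def using reach_inv adj_inv by blast
qed

lemma glues_recurrent_part:
  assumes Y: "glues adj Y" "\<And>g y. g \<in> carrier G \<Longrightarrow> y \<in> Y \<Longrightarrow> act g y \<in> Y" and w: "w \<in> Y"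
  shows "glues (wide T) (recurrent_part adj w T Y)"
  unfolding glues_def
proof (intro allI impI, elim conjE)
  fix E c
  assume cY': "\<forall>i\<in>E. c i \<in> recurrent_part adj w T Y"
    and cc: "\<forall>i\<in>E. \<forall>j\<in>E. wide T i j \<longrightarrow> c i = c j"
  \<comment> \<open>Only windows where \<open>c i\<close> really shows \<open>w\<close> are added,
    not all of \<open>reach T i\<close>: a window touching the added material has to find an
    occurrence there.\<close>
  define R where "R i = insert i {\<sigma> q t | q g t t'. q \<in> carrier G \<and> g \<in> carrier G \<and> t \<in> T \<and> t' \<in> T \<and>
      near adj T q g \<and> adj i (\<sigma> g t') \<and> occurs w T (c i) q}" for i
  have R_reach: "R i \<subseteq> reach T i" for i unfolding R_def reach_def by blast
  have agree: "c i = c j" if "i \<in> E" "j \<in> E" "a \<in> R i" "b \<in> R j" "adj a b" for i j a b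
    using cc that R_reach unfolding wide_def by blast
  define E1 where "E1 = (\<Union>i\<in>E. R i)"
  \<comment> \<open>The choice is immaterial: if \<open>a\<close> lies in both \<open>R i\<close>
    and \<open>R j\<close>, reflexivity of \<open>adj\<close> gives \<open>wide T i j\<close>, hence
    \<open>c i = c j\<close>.\<close>
  define c1 where "c1 a = c (SOME i. i \<in> E \<and> a \<in> R i)" for a
  have c1: "c1 a = c i" if "i \<in> E" "a \<in> R i" for i a
  proof -
    let ?k = "SOME k. k \<in> E \<and> a \<in> R k"
    have "?k \<in> E \<and> a \<in> R ?k" using that by (intro someI[of "\<lambda>k. k \<in> E \<and> a \<in> R k" i]) simp
    then show ?thesis unfolding c1_def using agree that adj_refl by blast
  qed
  \<comment> \<open>Windows without contact to the enlarged data \<open>E1\<close>. A maximal family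
    \<open>P\<close> of them, pairwise not near, can carry copies of \<open>w\<close> without
    conflict.\<close>
  define A where "A = {q\<in>carrier G. \<forall>t\<in>T. \<forall>a\<in>E1. \<not> adj (\<sigma> q t) a}"
  obtain P where P: "P \<subseteq> A" "\<And>p q. p \<in> P \<Longrightarrow> q \<in> P \<Longrightarrow> near adj T p q \<Longrightarrow> p = q"
    "\<And>q. q \<in> A \<Longrightarrow> q \<in> P \<or> (\<exists>p\<in>P. near adj T p q)"
    using maximal_independent_set[of "near adj T" A] near_sym by metis
  have PG: "q \<in> carrier G" if "q \<in> P" for q using P(1) that by (auto simp: A_def)
  define E2 where "E2 = {\<sigma> q t | q t. q \<in> P \<and> t \<in> T}"
  \<comment> \<open>Shifting by \<open>inv q\<close> puts the value \<open>w t\<close> at the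
    coordinate \<open>\<sigma> q t\<close>.\<close>
  define c2 where "c2 a = act (inv (SOME q. q \<in> P \<and> (\<exists>t\<in>T. a = \<sigma> q t))) w" for a
  have uniq: "q = q'" if "q \<in> P" "q' \<in> P" "t \<in> T" "t' \<in> T" "adj (\<sigma> q t) (\<sigma> q' t')" for q q' t t'
    using P(2) that unfolding near_def by blast
  have c2: "c2 (\<sigma> q t) = act (inv q) w" if qt: "q \<in> P" "t \<in> T" for q t
  proof -
    let ?k = "SOME k. k \<in> P \<and> (\<exists>s\<in>T. \<sigma> q t = \<sigma> k s)"
    have "?k \<in> P \<and> (\<exists>s\<in>T. \<sigma> q t = \<sigma> ?k s)"
      using qt by (intro someI[of "\<lambda>k. k \<in> P \<and> (\<exists>s\<in>T. \<sigma> q t = \<sigma> k s)" q]) blast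
    then obtain s where s: "?k \<in> P" "s \<in> T" "\<sigma> q t = \<sigma> ?k s" by blast
    have "adj (\<sigma> ?k s) (\<sigma> q t)" unfolding s(3)[symmetric] by (rule adj_refl)
    then have "?k = q" using uniq s(1,2) qt by blast
    then show ?thesis unfolding c2_def by simp
  qed
  have cross: "\<not> adj b a" if "a \<in> E1" "b \<in> E2" for a b
    using that P(1) by (auto simp: E2_def A_def)
  have cross': "\<not> adj a b" if "a \<in> E1" "b \<in> E2" for a b
    using cross[OF that] adj_sym[of a b] by blast
  define c3 where "c3 a = (if a \<in> E1 then c1 a else c2 a)" for a
  have cY: "c i \<in> Y" if "i \<in> E" for i using cY' that by (simp add: recurrent_part_def)
  have "\<forall>a\<in>E1 \<union> E2. c3 a \<in> Y"
  proof
    fix a assume a: "a \<in> E1 \<union> E2"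
    show "c3 a \<in> Y"
    proof (cases "a \<in> E1")
      case True
      then obtain i where "i \<in> E" "a \<in> R i" by (auto simp: E1_def)
      then show ?thesis using True c1 cY by (simp add: c3_def)
    next
      case False
      then obtain q t where "q \<in> P" "t \<in> T" "a = \<sigma> q t" using a by (auto simp: E2_def)
      then show ?thesis using False c2 Y(2) w PG by (simp add: c3_def)
    qed
  qed
  moreover have "\<forall>a\<in>E1 \<union> E2. \<forall>b\<in>E1 \<union> E2. adj a b \<longrightarrow> c3 a = c3 b"
  proof (intro ballI impI)
    fix a b assume ab: "a \<in> E1 \<union> E2" "b \<in> E1 \<union> E2" "adj a b"
    show "c3 a = c3 b"
    proof (cases "a \<in> E1")
      case True
      then have b: "b \<in> E1" using cross' ab by blast
      obtain i j where "i \<in> E" "a \<in> R i" "j \<in> E" "b \<in> R j" using True b by (auto simp: E1_def)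
      then have "c1 a = c1 b" using c1 agree ab(3) by metis
      then show ?thesis using True b by (simp add: c3_def)
    next
      case False
      then have b: "b \<notin> E1" using cross ab by blast
      obtain q t q' t' where *: "q \<in> P" "t \<in> T" "a = \<sigma> q t" "q' \<in> P" "t' \<in> T" "b = \<sigma> q' t'"
        using False b ab by (auto simp: E2_def)
      then have "q = q'" using uniq ab(3) by blast
      then show ?thesis using * c2 False b by (simp add: c3_def)
    qed
  qed
  ultimately have "\<exists>x\<in>Y. \<forall>a\<in>E1 \<union> E2. x a = c3 a a"
    by (intro Y(1)[unfolded glues_def, THEN spec, THEN spec, THEN mp] conjI)
  then obtain x where x: "x \<in> Y" "\<And>a. a \<in> E1 \<union> E2 \<Longrightarrow> x a = c3 a a" by blast
  have xR: "x a = c i a" if "i \<in> E" "a \<in> R i" for i a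
  proof -
    have "a \<in> E1" using that by (auto simp: E1_def)
    then show ?thesis using x(2) c1[OF that] by (simp add: c3_def)
  qed
  have xP: "occurs w T x q" if "q \<in> P" for q
    unfolding occurs_def
  proof
    fix t assume t: "t \<in> T"
    have "\<sigma> q t \<in> E2" "\<sigma> q t \<notin> E1" using that t cross adj_refl by (auto simp: E2_def)
    then show "x (\<sigma> q t) = w t"
      using x(2) c2[OF that t] \<sigma>_inv[OF PG[OF that]] by (simp add: c3_def act_def)
  qed
  have occ: "occurs w T x q"
    if "i \<in> E" "q \<in> carrier G" "g \<in> carrier G" "t' \<in> T" "near adj T q g" "adj i (\<sigma> g t')"
      "occurs w T (c i) q" for i q g t'
    unfolding occurs_def
  proof
    fix t assume "t \<in> T"
    then have "\<sigma> q t \<in> R i" unfolding R_def using that by blast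
    then show "x (\<sigma> q t) = w t" using xR that(1,7) \<open>t \<in> T\<close> by (simp add: occurs_def)
  qed
  have "\<exists>q\<in>carrier G. near adj T q g \<and> occurs w T x q" if g: "g \<in> carrier G" for g
  proof (cases "\<exists>t\<in>T. \<exists>a\<in>E1. adj (\<sigma> g t) a")
    case True
    then obtain t a i where *: "t \<in> T" "adj (\<sigma> g t) a" "i \<in> E" "a \<in> R i" by (auto simp: E1_def)
    show ?thesis
    proof (cases "a = i")
      \<comment> \<open>The window at \<open>g\<close> touches \<open>i\<close> itself, so the
        occurrence that \<open>c i\<close> has near \<open>g\<close> belongs to \<open>R i\<close>
        and was copied.\<close>
      case True
      obtain q where "q \<in> carrier G" "near adj T q g" "occurs w T (c i) q"
        using cY' *(3) g unfolding recurrent_part_def by blast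
      then show ?thesis using occ[of i q g t] * g True adj_sym by blast
    next
      \<comment> \<open>The touched point belongs to a preserved occurrence, which is therefore
        itself near \<open>g\<close>.\<close>
      case False
      then obtain q g' s t' where **: "q \<in> carrier G" "g' \<in> carrier G" "s \<in> T" "t' \<in> T" "near adj T q g'"
          "adj i (\<sigma> g' t')" "occurs w T (c i) q" "a = \<sigma> q s"
        using *(4) unfolding R_def by blast
      have "near adj T q g" unfolding near_def using * ** adj_sym by blast
      then show ?thesis using occ[OF *(3) **(1,2,4-7)] **(1) by blast
    qed
  next
    case False
    then have "g \<in> A" using g by (auto simp: A_def)
    then obtain p where "p \<in> P" "near adj T p g" using P(3)[of g] unfolding near_def by blast
    then show ?thesis using xP PG by blast
  qed
  then have "x \<in> recurrent_part adj w T Y" using x(1) by (simp add: recurrent_part_def)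
  moreover have "\<forall>i\<in>E. x i = c i i" using xR by (simp add: R_def)
  ultimately show "\<exists>x\<in>recurrent_part adj w T Y. \<forall>i\<in>E. x i = c i i" by blast
qed

end

text \<open>\<open>K\<close> consists of the times near \<one>: the recurrence condition at
  \<open>g = \<one>\<close> already gives a bound uniform in \<open>y\<close>.\<close>

lemma irreducible_recurrent_part:
  assumes Y: "irreducible_shift Y" and w: "w \<in> Y" and T: "finite T"
  shows "\<exists>Y' K. irreducible_shift Y' \<and> Y' \<subseteq> Y \<and> finite K \<and> K \<subseteq> carrier G \<and>
    (\<forall>y\<in>Y'. \<exists>q\<in>K. \<forall>t\<in>T. act q y t = w t)"
proof -
  obtain adj where adj: "local_rel adj" "glues adj Y"
    and Y': "closed Y" "\<And>y i. y \<in> Y \<Longrightarrow> y i \<in> {0,1,2}" "\<And>g y. g \<in> carrier G \<Longrightarrow> y \<in> Y \<Longrightarrow> act g y \<in> Y"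
    using Y unfolding irreducible_shift_def by blast
  let ?Y = "recurrent_part adj w T Y"
  \<comment> \<open>For each \<open>g\<close> only finitely many \<open>q\<close> are near, so the
    condition is a finite union of closed ones.\<close>
  have "?Y = Y \<inter> (\<Inter>g\<in>carrier G. \<Union>q\<in>{q\<in>carrier G. near adj T q g}. \<Inter>t\<in>T. {y. y (\<sigma> q t) = w t})"
    by (simp add: recurrent_part_def occurs_def set_eq_iff Bex_def conj_assoc)
  moreover have "closed \<dots>"
    using finite_near[OF adj(1) T] Y'(1) closed_coordinate_eq
    by (intro closed_Int closed_INT ballI closed_UN) auto
  ultimately have "closed ?Y" by simp
  moreover have "act h y \<in> ?Y" if h: "h \<in> carrier G" "y \<in> ?Y" for h y
  proof -
    have "\<exists>q\<in>carrier G. near adj T q g \<and> occurs w T (act h y) q" if g: "g \<in> carrier G" for g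
    proof -
      obtain q where q: "q \<in> carrier G" "near adj T q (g \<otimes> h)" "occurs w T y q"
        using h g unfolding recurrent_part_def by blast
      have "near adj T (q \<otimes> inv h) g"
        using near_mult[OF adj(1) q(1) _ _ q(2), of "inv h"] g h by (simp add: m_assoc)
      moreover have "occurs w T (act h y) (q \<otimes> inv h)"
        using q h by (simp add: occurs_def act_def \<sigma>_mult \<sigma>_inv')
      ultimately show ?thesis using q h by blast
    qed
    then show ?thesis using h Y'(3) by (simp add: recurrent_part_def)
  qed
  ultimately have "irreducible_shift ?Y"
    unfolding irreducible_shift_def
    using Y'(2) local_rel_wide[OF adj(1) T] glues_recurrent_part[OF adj Y'(3) w]
    by (auto simp: recurrent_part_def)
  moreover have "\<forall>y\<in>?Y. \<exists>q\<in>{q\<in>carrier G. near adj T q \<one>}. \<forall>t\<in>T. act q y t = w t"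
  proof
    fix y assume "y \<in> ?Y"
    then obtain q where "q \<in> carrier G" "near adj T q \<one>" "occurs w T y q"
      unfolding recurrent_part_def by blast
    then show "\<exists>q\<in>{q\<in>carrier G. near adj T q \<one>}. \<forall>t\<in>T. act q y t = w t"
      by (intro bexI[of _ q]) (auto simp: occurs_def act_def)
  qed
  moreover have "?Y \<subseteq> Y" by (auto simp: recurrent_part_def)
  ultimately show ?thesis using finite_near[OF adj(1) T]
    by (intro exI[of _ ?Y] exI[of _ "{q\<in>carrier G. near adj T q \<one>}"]) auto
qed

end

section \<open>Simultaneous recurrence\<close>

text \<open>Greedy choice: a point already chosen excludes only finitely many \<open>h\<close>, and
  the group is infinite.\<close>

lemma (in group) separated_subset_of_syndetic:
  assumes inf: "infinite (carrier G)" and A: "A \<subseteq> carrier G"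
    and K: "finite K" "K \<subseteq> carrier G" "\<And>h. h \<in> carrier G \<Longrightarrow> \<exists>k\<in>K. k \<otimes> h \<in> A"
    and D: "finite D" "D \<subseteq> carrier G" "D \<noteq> {}"
  shows "\<exists>B\<subseteq>A. finite B \<and> card B = N \<and>
    (\<forall>b\<in>B. \<forall>b'\<in>B. \<forall>\<delta>\<in>D. \<forall>\<delta>'\<in>D. \<delta> \<otimes> b = \<delta>' \<otimes> b' \<longrightarrow> b = b')"
proof (induction N)
  case (Suc N)
  then obtain B where B: "B \<subseteq> A" "finite B" "card B = N"
    and sep: "\<And>b b' \<delta> \<delta>'. b \<in> B \<Longrightarrow> b' \<in> B \<Longrightarrow> \<delta> \<in> D \<Longrightarrow> \<delta>' \<in> D \<Longrightarrow> \<delta> \<otimes> b = \<delta>' \<otimes> b' \<Longrightarrow> b = b'"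
    by blast
  \<comment> \<open>Every \<open>h\<close> for which some \<open>k \<otimes> h\<close> could collide
    with \<open>B\<close>. All \<open>k \<in> K\<close> are included because \<open>k\<close> is
    known only after \<open>h\<close>.\<close>
  define Z where "Z = (\<lambda>(\<delta>, k, \<delta>', b). inv (\<delta> \<otimes> k) \<otimes> (\<delta>' \<otimes> b)) ` (D \<times> K \<times> D \<times> B)"
  have "finite Z" unfolding Z_def using B D K by simp
  then obtain h where h: "h \<in> carrier G" "h \<notin> Z"
    using inf by (meson finite_subset subsetI)
  obtain k where k: "k \<in> K" "k \<otimes> h \<in> A" using K(3) h(1) by blast
  have new: "\<delta> \<otimes> (k \<otimes> h) \<noteq> \<delta>' \<otimes> b" if "\<delta> \<in> D" "\<delta>' \<in> D" "b \<in> B" for \<delta> \<delta>' b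
  proof
    assume eq: "\<delta> \<otimes> (k \<otimes> h) = \<delta>' \<otimes> b"
    have car: "\<delta> \<in> carrier G" "\<delta>' \<in> carrier G" "b \<in> carrier G" "k \<in> carrier G"
      using that D(2) A B(1) K(2) k(1) by auto
    have "h = inv (\<delta> \<otimes> k) \<otimes> (\<delta>' \<otimes> b)"
      using car h(1) by (simp add: inv_solve_left m_assoc eq)
    then have "h \<in> Z" unfolding Z_def using that k(1)
      by (intro image_eqI[of _ _ "(\<delta>, k, \<delta>', b)"]) auto
    then show False using h(2) by simp
  qed
  obtain \<delta>0 where \<delta>0: "\<delta>0 \<in> D" using D(3) by blast
  have "k \<otimes> h \<notin> B" using new[OF \<delta>0 \<delta>0] by blast
  then have "card (insert (k \<otimes> h) B) = Suc N" using B by simp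
  moreover have "\<forall>b\<in>insert (k \<otimes> h) B. \<forall>b'\<in>insert (k \<otimes> h) B. \<forall>\<delta>\<in>D. \<forall>\<delta>'\<in>D.
      \<delta> \<otimes> b = \<delta>' \<otimes> b' \<longrightarrow> b = b'"
  proof (intro ballI impI)
    fix b b' \<delta> \<delta>'
    assume *: "b \<in> insert (k \<otimes> h) B" "b' \<in> insert (k \<otimes> h) B" "\<delta> \<in> D" "\<delta>' \<in> D" "\<delta> \<otimes> b = \<delta>' \<otimes> b'"
    show "b = b'"
    proof (cases "b \<in> B"; cases "b' \<in> B")
      assume "b \<in> B" "b' \<in> B" then show ?thesis using sep[OF _ _ *(3,4,5)] by blast
    next
      assume "b \<in> B" "b' \<notin> B" then show ?thesis using new[OF *(4,3), of b] * by auto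
    next
      assume "b \<notin> B" "b' \<in> B" then show ?thesis using new[OF *(3,4), of b'] * by auto
    next
      assume "b \<notin> B" "b' \<notin> B" then show ?thesis using * by auto
    qed
  qed
  ultimately show ?case using B k(2) by (intro exI[of _ "insert (k \<otimes> h) B"]) auto
qed auto

lemma minimal_flow_finite_return:
  assumes X: "minimal_flow G X a" and U: "openin X U" "U \<noteq> {}"
  shows "\<exists>K. finite K \<and> K \<subseteq> carrier G \<and> (\<forall>x\<in>topspace X. \<exists>k\<in>K. a k x \<in> U)"
proof -
  have flow: "compact_space X" "\<And>g. g \<in> carrier G \<Longrightarrow> continuous_map X X (a g)"
    and dense: "\<And>x. x \<in> topspace X \<Longrightarrow> X closure_of (orbit G a x) = topspace X"
    using X by (auto simp: minimal_flow_def G_flow_def)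
  define V where "V g = {x \<in> topspace X. a g x \<in> U}" for g
  have ret: "\<exists>g\<in>carrier G. x \<in> V g" if x: "x \<in> topspace X" for x
  proof -
    obtain u where u: "u \<in> U" using U(2) by blast
    then have "u \<in> X closure_of (orbit G a x)" using dense[OF x] openin_subset[OF U(1)] by auto
    then obtain y where "y \<in> orbit G a x" "y \<in> U" using u U(1) by (auto simp: in_closure_of)
    then show ?thesis using x by (auto simp: orbit_def V_def)
  qed
  have "openin X (V g)" if "g \<in> carrier G" for g
    unfolding V_def using flow(2)[OF that] U(1) by (rule openin_continuous_map_preimage)
  moreover have "topspace X \<subseteq> \<Union>(V ` carrier G)" using ret by blast
  ultimately obtain \<F> where \<F>: "finite \<F>" "\<F> \<subseteq> V ` carrier G" "topspace X \<subseteq> \<Union>\<F>"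
    using flow(1) unfolding compact_space_alt by (metis (no_types, lifting) imageE)
  then obtain K where "K \<subseteq> carrier G" "finite K" "\<F> = V ` K"
    by (meson finite_subset_image)
  then show ?thesis using \<F>(3) by (intro exI[of _ K]) (auto simp: V_def)
qed

section \<open>Planting a pattern, and induction on the number of shifts\<close>

context index_action
begin

text \<open>\<open>D\<close> collects the \<delta> whose window on \<open>W\<close> is near the
  window at \<one>. A set separated by \<open>D\<close> thus has pairwise non-adjacent windows, and
  translates of \<open>p\<close> on them can be glued.\<close>

lemma place_separated_copies:
  assumes Y: "irreducible_shift Y" and p: "p \<in> Y" and W: "finite W"
  shows "\<exists>D. finite D \<and> D \<subseteq> carrier G \<and> \<one> \<in> D \<and>
    (\<forall>S\<subseteq>carrier G. (\<forall>s\<in>S. \<forall>\<delta>\<in>D. \<delta> \<otimes> s \<in> S \<longrightarrow> \<delta> = \<one>) \<longrightarrow>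
      (\<exists>w\<in>Y. \<forall>s\<in>S. \<forall>i\<in>W. w (\<sigma> s i) = p i))"
proof -
  obtain adj where adj: "local_rel adj" "glues adj Y"
    and inv: "\<And>g y. g \<in> carrier G \<Longrightarrow> y \<in> Y \<Longrightarrow> act g y \<in> Y"
    using Y unfolding irreducible_shift_def by blast
  define D where "D = {\<delta>\<in>carrier G. near adj W \<delta> \<one>}"
  have "\<exists>w\<in>Y. \<forall>s\<in>S. \<forall>i\<in>W. w (\<sigma> s i) = p i"
    if S: "S \<subseteq> carrier G" and sep: "\<forall>s\<in>S. \<forall>\<delta>\<in>D. \<delta> \<otimes> s \<in> S \<longrightarrow> \<delta> = \<one>" for S
  proof -
    have uniq: "s = s'" if st: "s \<in> S" "s' \<in> S" "i \<in> W" "i' \<in> W" "adj (\<sigma> s i) (\<sigma> s' i')" for s s' i i'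
    proof -
      have car: "s \<in> carrier G" "s' \<in> carrier G" using st S by auto
      have "near adj W s s'" using st by (auto simp: near_def)
      \<comment> \<open>Right invariance of \<open>near\<close> moves adjacency of two windows to
        \<one>, which is the form in which separation is stated.\<close>
      then have "near adj W (s \<otimes> inv s') \<one>"
        using near_mult[OF adj(1) car, of "inv s'" W] car by simp
      then have "s \<otimes> inv s' \<in> D" using car by (simp add: D_def)
      moreover have eq: "(s \<otimes> inv s') \<otimes> s' = s" using car by (simp add: m_assoc)
      ultimately have "s \<otimes> inv s' = \<one>" using sep st(1,2) by metis
      then show ?thesis using eq car by simp
    qed
    define E where "E = {\<sigma> s i | s i. s \<in> S \<and> i \<in> W}"
    define c where "c a = act (inv (SOME s. s \<in> S \<and> (\<exists>i\<in>W. a = \<sigma> s i))) p" for a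
    have c: "c (\<sigma> s i) = act (inv s) p" if si: "s \<in> S" "i \<in> W" for s i
    proof -
      let ?k = "SOME k. k \<in> S \<and> (\<exists>j\<in>W. \<sigma> s i = \<sigma> k j)"
      have "?k \<in> S \<and> (\<exists>j\<in>W. \<sigma> s i = \<sigma> ?k j)"
        using si by (intro someI[of "\<lambda>k. k \<in> S \<and> (\<exists>j\<in>W. \<sigma> s i = \<sigma> k j)" s]) blast
      then obtain j where j: "?k \<in> S" "j \<in> W" "\<sigma> s i = \<sigma> ?k j" by blast
      have "adj (\<sigma> ?k j) (\<sigma> s i)" unfolding j(3)[symmetric] by (rule adj_refl[OF adj(1)])
      then have "?k = s" using uniq j(1,2) si by blast
      then show ?thesis unfolding c_def by simp
    qed
    have "\<forall>a\<in>E. c a \<in> Y" using c inv p S by (auto simp: E_def)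
    moreover have "\<forall>a\<in>E. \<forall>b\<in>E. adj a b \<longrightarrow> c a = c b"
    proof (intro ballI impI)
      fix a b assume "a \<in> E" "b \<in> E" and ab: "adj a b"
      then obtain s i s' i' where *: "s \<in> S" "i \<in> W" "a = \<sigma> s i" "s' \<in> S" "i' \<in> W" "b = \<sigma> s' i'"
        by (auto simp: E_def)
      then have "s = s'" using uniq ab by blast
      then show "c a = c b" using * c by simp
    qed
    ultimately have "\<exists>x\<in>Y. \<forall>a\<in>E. x a = c a a"
      by (intro adj(2)[unfolded glues_def, THEN spec, THEN spec, THEN mp] conjI)
    then obtain w where w: "w \<in> Y" "\<And>a. a \<in> E \<Longrightarrow> w a = c a a" by blast
    have "w (\<sigma> s i) = p i" if si: "s \<in> S" "i \<in> W" for s i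
    proof -
      have "\<sigma> s i \<in> E" using si by (auto simp: E_def)
      then have "w (\<sigma> s i) = act (inv s) p (\<sigma> s i)" using w(2) c[OF si] by simp
      then show ?thesis using \<sigma>_inv[of s i] si S by (auto simp: act_def)
    qed
    then show ?thesis using w(1) by blast
  qed
  moreover have "finite D" unfolding D_def using finite_near[OF adj(1) W] .
  moreover have "\<one> \<in> D" "D \<subseteq> carrier G" by (auto simp: D_def near_def)
  ultimately show ?thesis by (intro exI[of _ D] conjI allI impI)
qed

text \<open>The target stays general in the induction because the hypothesis is used twice: first
  for syndetically many returns of one reference point to the original target, then for returns of
  all points to a neighbourhood of that reference point.\<close>

lemma simultaneous_recurrence:
  assumes X: "minimal_flow G X a" and inf: "infinite (carrier G)" and \<Lambda>: "finite \<Lambda>"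
    and "\<forall>l\<in>\<Lambda>. irreducible_shift (Y l) \<and> q l \<in> Y l"
    and "openin X U" "U \<noteq> {}" "finite W"
  shows "\<exists>Y' K. finite K \<and> K \<subseteq> carrier G \<and> (\<forall>l\<in>\<Lambda>. irreducible_shift (Y' l) \<and> Y' l \<subseteq> Y l) \<and>
    (\<forall>x\<in>topspace X. \<forall>y. (\<forall>l\<in>\<Lambda>. y l \<in> Y' l) \<longrightarrow>
      (\<exists>k\<in>K. a k x \<in> U \<and> (\<forall>l\<in>\<Lambda>. \<forall>i\<in>W. act k (y l) i = q l i)))"
  using \<Lambda> assms(4-)
proof (induction \<Lambda> arbitrary: Y q U W rule: finite_induct)
  case empty
  obtain K where "finite K" "K \<subseteq> carrier G" "\<forall>x\<in>topspace X. \<exists>k\<in>K. a k x \<in> U"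
    using minimal_flow_finite_return[OF X empty(2,3)] by blast
  then show ?case by (intro exI[of _ Y] exI[of _ K]) auto
next
  case (insert m \<Lambda>)
  have flow: "\<And>g. g \<in> carrier G \<Longrightarrow> continuous_map X X (a g)" "topspace X \<noteq> {}"
    "\<And>g h x. g \<in> carrier G \<Longrightarrow> h \<in> carrier G \<Longrightarrow> x \<in> topspace X \<Longrightarrow> a (g \<otimes> h) x = a g (a h x)"
    using X by (auto simp: minimal_flow_def G_flow_def)
  have atop: "a g x \<in> topspace X" if "g \<in> carrier G" "x \<in> topspace X" for g x
    using flow(1)[OF that(1)] that(2) by (auto simp: continuous_map_def)
  have Yq: "\<forall>l\<in>\<Lambda>. irreducible_shift (Y l) \<and> q l \<in> Y l"
    and Ym: "irreducible_shift (Y m)" "q m \<in> Y m"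
    using insert.prems(1) by auto
  obtain Y1 K1 where K1: "finite K1" "K1 \<subseteq> carrier G"
    and Y1': "\<forall>l\<in>\<Lambda>. irreducible_shift (Y1 l) \<and> Y1 l \<subseteq> Y l"
    and hit1': "\<forall>x\<in>topspace X. \<forall>y. (\<forall>l\<in>\<Lambda>. y l \<in> Y1 l) \<longrightarrow>
      (\<exists>k\<in>K1. a k x \<in> U \<and> (\<forall>l\<in>\<Lambda>. \<forall>i\<in>W. act k (y l) i = q l i))"
    using insert.IH[OF Yq insert.prems(2,3,4)] by (elim exE conjE)
  have Y1: "irreducible_shift (Y1 l)" "Y1 l \<subseteq> Y l" if "l \<in> \<Lambda>" for l
    using Y1' that by auto
  have hit1: "\<exists>k\<in>K1. a k x \<in> U \<and> (\<forall>l\<in>\<Lambda>. \<forall>i\<in>W. act k (y l) i = q l i)"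
    if "x \<in> topspace X" "\<And>l. l \<in> \<Lambda> \<Longrightarrow> y l \<in> Y1 l" for x y
    using hit1' that by simp
  have Y1_inv: "act g y \<in> Y1 l" if "l \<in> \<Lambda>" "g \<in> carrier G" "y \<in> Y1 l" for g y l
    using Y1(1)[OF that(1)] that(2,3) by (simp add: irreducible_shift_def)
  obtain x0 where x0: "x0 \<in> topspace X" using flow(2) by blast
  define y0 where "y0 l = (SOME y. y \<in> Y1 l)" for l
  have y0: "y0 l \<in> Y1 l" if "l \<in> \<Lambda>" for l
    unfolding y0_def using irreducible_shift_nonempty[OF Y1(1)[OF that]] by (simp add: some_in_eq)
  then have Y1y0: "\<forall>l\<in>\<Lambda>. irreducible_shift (Y1 l) \<and> y0 l \<in> Y1 l" using Y1(1) by auto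
  \<comment> \<open>It suffices to find a finite \<open>D\<close>-separated \<open>S\<close> such that every point of \<open>X\<close> times the shifts over
    \<open>\<Lambda>\<close> hits its target at a time in \<open>S\<close>: then copies of \<open>q m\<close> on all of \<open>S\<close> form one pattern of \<open>Y m\<close>,
    which can be made recurrent. Such an \<open>S\<close> has to meet \<open>B k\<close> for all \<open>k \<in> K2\<close>, where \<open>B\<close> is a
    large set of return times of one point and \<open>K2\<close> bounds the returns to that behaviour.\<close>
  define A where "A = {g\<in>carrier G. a g x0 \<in> U \<and> (\<forall>l\<in>\<Lambda>. \<forall>i\<in>W. act g (y0 l) i = q l i)}"
  have synd: "\<exists>k\<in>K1. k \<otimes> h \<in> A" if h: "h \<in> carrier G" for h
  proof -
    obtain k where k: "k \<in> K1" "a k (a h x0) \<in> U" "\<forall>l\<in>\<Lambda>. \<forall>i\<in>W. act k (act h (y0 l)) i = q l i"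
      using hit1[of "a h x0" "\<lambda>l. act h (y0 l)"] atop[OF h x0] Y1_inv h y0 by blast
    have "k \<in> carrier G" using k(1) K1(2) by blast
    then have "k \<otimes> h \<in> A" using k h x0 by (simp add: A_def flow(3) act_mult)
    then show ?thesis using k(1) by blast
  qed
  obtain D where D: "finite D" "D \<subseteq> carrier G" "\<one> \<in> D"
    and place: "\<And>S. S \<subseteq> carrier G \<Longrightarrow> \<forall>s\<in>S. \<forall>\<delta>\<in>D. \<delta> \<otimes> s \<in> S \<longrightarrow> \<delta> = \<one> \<Longrightarrow>
      \<exists>w\<in>Y m. \<forall>s\<in>S. \<forall>i\<in>W. w (\<sigma> s i) = q m i"
    using place_separated_copies[OF Ym insert.prems(4)] by auto
  obtain N where N: "\<forall>B F. B \<subseteq> carrier G \<longrightarrow> card B = N \<longrightarrow>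
      (\<forall>b\<in>B. \<forall>b'\<in>B. \<forall>\<delta>\<in>D. \<forall>\<delta>'\<in>D. \<delta> \<otimes> b = \<delta>' \<otimes> b' \<longrightarrow> b = b') \<longrightarrow>
      finite F \<longrightarrow> F \<subseteq> carrier G \<longrightarrow>
      (\<exists>S. finite S \<and> S \<subseteq> carrier G \<and> (\<forall>f\<in>F. \<exists>b\<in>B. b \<otimes> f \<in> S) \<and>
        (\<forall>s\<in>S. \<forall>\<delta>\<in>D. \<delta> \<otimes> s \<in> S \<longrightarrow> \<delta> = \<one>))"
    using separated_hitting_set[OF D] ..
  have "A \<subseteq> carrier G" by (auto simp: A_def)
  then obtain B where B: "B \<subseteq> A" "finite B" "card B = N"
      "\<forall>b\<in>B. \<forall>b'\<in>B. \<forall>\<delta>\<in>D. \<forall>\<delta>'\<in>D. \<delta> \<otimes> b = \<delta>' \<otimes> b' \<longrightarrow> b = b'"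
    using separated_subset_of_syndetic[OF inf _ K1 synd D(1,2)] D(3) by (metis (no_types, lifting) empty_iff)
  have B': "B \<subseteq> carrier G" using B(1) by (auto simp: A_def)
  have BG: "b \<in> carrier G" if "b \<in> B" for b using B(1) that by (auto simp: A_def)
  \<comment> \<open>\<open>V\<close> and \<open>W'\<close> are chosen so that every point resembling
    \<open>(x0, y0)\<close> there hits the target at each time \<open>b \<in> B\<close>.\<close>
  define V where "V = topspace X \<inter> (\<Inter>b\<in>B. {x \<in> topspace X. a b x \<in> U})"
  define W' where "W' = (\<Union>b\<in>B. \<sigma> b ` W)"
  have V: "openin X V"
    unfolding V_def using B(2) BG flow(1) insert.prems(2)
    by (intro openin_Int_Inter) (auto intro: openin_continuous_map_preimage)
  have "x0 \<in> V" using B(1) x0 by (auto simp: V_def A_def)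
  then have V0: "V \<noteq> {}" by blast
  have W': "finite W'" using B(2) insert.prems(4) by (simp add: W'_def)
  obtain Y2 K2 where K2: "finite K2" "K2 \<subseteq> carrier G"
    and Y2': "\<forall>l\<in>\<Lambda>. irreducible_shift (Y2 l) \<and> Y2 l \<subseteq> Y1 l"
    and hit2': "\<forall>x\<in>topspace X. \<forall>y. (\<forall>l\<in>\<Lambda>. y l \<in> Y2 l) \<longrightarrow>
      (\<exists>k\<in>K2. a k x \<in> V \<and> (\<forall>l\<in>\<Lambda>. \<forall>i\<in>W'. act k (y l) i = y0 l i))"
    using insert.IH[OF Y1y0 V V0 W'] by (elim exE conjE)
  have Y2: "irreducible_shift (Y2 l)" "Y2 l \<subseteq> Y1 l" if "l \<in> \<Lambda>" for l
    using Y2' that by auto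
  have hit2: "\<exists>k\<in>K2. a k x \<in> V \<and> (\<forall>l\<in>\<Lambda>. \<forall>i\<in>W'. act k (y l) i = y0 l i)"
    if "x \<in> topspace X" "\<And>l. l \<in> \<Lambda> \<Longrightarrow> y l \<in> Y2 l" for x y
    using hit2' that by simp
  obtain S where S: "finite S" "S \<subseteq> carrier G" "\<And>k. k \<in> K2 \<Longrightarrow> \<exists>b\<in>B. b \<otimes> k \<in> S"
    and S_sep: "\<forall>s\<in>S. \<forall>\<delta>\<in>D. \<delta> \<otimes> s \<in> S \<longrightarrow> \<delta> = \<one>"
    using N[THEN spec, THEN spec, THEN mp, THEN mp, THEN mp, THEN mp, THEN mp, OF B' B(3,4) K2]
    by blast
  have hitS: "\<exists>s\<in>S. a s x \<in> U \<and> (\<forall>l\<in>\<Lambda>. \<forall>i\<in>W. act s (y l) i = q l i)"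
    if x: "x \<in> topspace X" and y: "\<And>l. l \<in> \<Lambda> \<Longrightarrow> y l \<in> Y2 l" for x y
  proof -
    obtain k where k: "k \<in> K2" "a k x \<in> V" "\<forall>l\<in>\<Lambda>. \<forall>i\<in>W'. act k (y l) i = y0 l i"
      using hit2[of x y] x y by blast
    obtain b where b: "b \<in> B" "b \<otimes> k \<in> S" using S(3)[OF k(1)] by blast
    have car: "b \<in> carrier G" "k \<in> carrier G" using BG[OF b(1)] K2(2) k(1) by auto
    have "a (b \<otimes> k) x \<in> U" using flow(3)[OF car x] k(2) b(1) by (auto simp: V_def)
    moreover have "act (b \<otimes> k) (y l) i = q l i" if li: "l \<in> \<Lambda>" "i \<in> W" for l i
    proof -
      have "act (b \<otimes> k) (y l) i = act k (y l) (\<sigma> b i)"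
        using act_mult[OF car] by (simp add: act_def)
      also have "\<dots> = y0 l (\<sigma> b i)" using k(3) b(1) li by (auto simp: W'_def)
      also have "\<dots> = q l i" using B(1) b(1) li by (auto simp: A_def act_def)
      finally show ?thesis .
    qed
    ultimately show ?thesis using b(2) by blast
  qed
  obtain w where w: "w \<in> Y m" "\<And>s i. s \<in> S \<Longrightarrow> i \<in> W \<Longrightarrow> w (\<sigma> s i) = q m i"
    using place[OF S(2) S_sep] by blast
  define T where "T = (\<Union>s\<in>S. \<sigma> s ` W)"
  have T: "finite T" using S(1) insert.prems(4) by (simp add: T_def)
  obtain Ym Km where Ym': "irreducible_shift Ym" "Ym \<subseteq> Y m" and Km: "finite Km" "Km \<subseteq> carrier G"
    and hitm: "\<forall>y\<in>Ym. \<exists>k\<in>Km. \<forall>t\<in>T. act k y t = w t"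
    using irreducible_recurrent_part[OF Ym(1) w(1) T] by (elim exE conjE)
  \<comment> \<open>A time in \<open>Km\<close> brings up \<open>w\<close>; then some
    \<open>s \<in> S\<close> hits the other targets, and \<open>w\<close> shows \<open>q m\<close>
    at \<open>s\<close> whichever \<open>s\<close> it is.\<close>
  define K where "K = (\<lambda>(s, k). s \<otimes> k) ` (S \<times> Km)"
  have K: "finite K" "K \<subseteq> carrier G" using S Km by (auto simp: K_def)
  have good: "irreducible_shift ((Y2(m := Ym)) l) \<and> (Y2(m := Ym)) l \<subseteq> Y l" if "l \<in> insert m \<Lambda>" for l
    using that Ym' Y1(2)[of l] Y2[of l] insert.hyps(2) by (cases "l = m") auto
  have "\<exists>k\<in>K. a k x \<in> U \<and> (\<forall>l\<in>insert m \<Lambda>. \<forall>i\<in>W. act k (y l) i = q l i)"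
    if x: "x \<in> topspace X" and y: "\<forall>l\<in>insert m \<Lambda>. y l \<in> (Y2(m := Ym)) l" for x y
  proof -
    have ym: "y m \<in> Ym" using y by simp
    have yl: "y l \<in> Y2 l" if "l \<in> \<Lambda>" for l using y that insert.hyps(2) by (metis fun_upd_other insertCI)
    obtain k where k: "k \<in> Km" "\<forall>t\<in>T. act k (y m) t = w t" using bspec[OF hitm ym] by blast
    have kG: "k \<in> carrier G" using k(1) Km(2) by blast
    have "act k (y l) \<in> Y2 l" if "l \<in> \<Lambda>" for l
      using Y2(1)[OF that] yl[OF that] kG by (simp add: irreducible_shift_def)
    then obtain s where s: "s \<in> S" "a s (a k x) \<in> U" "\<forall>l\<in>\<Lambda>. \<forall>i\<in>W. act s (act k (y l)) i = q l i"
      using hitS[of "a k x" "\<lambda>l. act k (y l)"] atop[OF kG x] by blast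
    have sG: "s \<in> carrier G" using s(1) S(2) by blast
    have "a (s \<otimes> k) x \<in> U" using s(2) flow(3)[OF sG kG x] by simp
    moreover have "act (s \<otimes> k) (y l) i = q l i" if li: "l \<in> insert m \<Lambda>" "i \<in> W" for l i
    proof (cases "l = m")
      case True
      have "\<sigma> s i \<in> T" using s(1) li(2) by (auto simp: T_def)
      then have "act k (y m) (\<sigma> s i) = q m i" using k(2) w(2) s(1) li(2) by simp
      then show ?thesis using True act_mult[OF sG kG] by (simp add: act_def)
    next
      case False
      then show ?thesis using li s(3) act_mult[OF sG kG] by simp
    qed
    moreover have "s \<otimes> k \<in> K" using s(1) k(1) by (auto simp: K_def)
    ultimately show ?thesis by blast
  qed
  then show ?case using K good by (intro exI[of _ "Y2(m := Ym)"] exI[of _ K] conjI ballI allI impI) auto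
qed

end

section \<open>A tree of shifts\<close>

lemma eventually_initial_segments_distinct:
  assumes "finite R"
  shows "\<forall>\<^sub>F M in sequentially. \<forall>c\<in>R. \<forall>d\<in>R. c \<inter> {..<M} = d \<inter> {..<M} \<longrightarrow> c = (d :: nat set)"
proof (intro eventually_ball_finite assms ballI)
  fix c d :: "nat set"
  show "\<forall>\<^sub>F M in sequentially. c \<inter> {..<M} = d \<inter> {..<M} \<longrightarrow> c = d"
  proof (cases "c = d")
    case False
    then obtain m where m: "m \<in> c \<longleftrightarrow> m \<notin> d" by blast
    have "\<forall>\<^sub>F M in sequentially. m < M" by (rule eventually_gt_at_top)
    then show ?thesis
    proof (rule eventually_mono)
      fix M assume "m < M"
      then have "m \<in> c \<inter> {..<M} \<longleftrightarrow> m \<notin> d \<inter> {..<M}" using m by simp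
      then show "c \<inter> {..<M} = d \<inter> {..<M} \<longrightarrow> c = d" by blast
    qed
  qed simp
qed

context index_action
begin

text \<open>Only finitely many patterns fit on \<open>W\<close>, so they are treated one after
  another together with the open sets. A pattern lost on the way leaves no obligation, since
  \<open>p\<close> ranges over the final shifts.\<close>

lemma recurrence_of_all_patterns:
  fixes \<Lambda> :: "'l set"
  assumes X: "minimal_flow G X a" and inf: "infinite (carrier G)" and \<Lambda>: "finite \<Lambda>"
    and Y: "\<forall>l\<in>\<Lambda>. irreducible_shift (Y l)"
    and \<U>: "finite \<U>" "\<forall>U\<in>\<U>. openin X U \<and> U \<noteq> {}" and W: "finite W"
  shows "\<exists>Y'. (\<forall>l\<in>\<Lambda>. irreducible_shift (Y' l) \<and> Y' l \<subseteq> Y l) \<and>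
    (\<forall>U\<in>\<U>. \<forall>x\<in>topspace X. \<forall>y p. (\<forall>l\<in>\<Lambda>. y l \<in> Y' l \<and> p l \<in> Y' l) \<longrightarrow>
      (\<exists>k\<in>carrier G. a k x \<in> U \<and> (\<forall>l\<in>\<Lambda>. \<forall>i\<in>W. act k (y l) i = p l i)))"
proof -
  \<comment> \<open>Both \<open>y\<close> and \<open>p\<close> range over \<open>Z\<close>, so
    shrinking \<open>Z\<close> preserves what has been achieved; \<open>r\<close> only names the
    restriction of \<open>p\<close> to \<open>W\<close>.\<close>
  define achieved where "achieved Z U r \<longleftrightarrow>
    (\<forall>x\<in>topspace X. \<forall>y p. (\<forall>l\<in>\<Lambda>. y l \<in> Z l \<and> p l \<in> Z l \<and> (\<forall>i\<in>W. p l i = r l i)) \<longrightarrow>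
      (\<exists>k\<in>carrier G. a k x \<in> U \<and> (\<forall>l\<in>\<Lambda>. \<forall>i\<in>W. act k (y l) i = p l i)))"
    for Z :: "'l \<Rightarrow> (nat \<Rightarrow> real) set" and U and r :: "'l \<Rightarrow> nat \<Rightarrow> real"
  have mono: "achieved Z' U r" if ach: "achieved Z U r" and sub: "\<And>l. l \<in> \<Lambda> \<Longrightarrow> Z' l \<subseteq> Z l" for Z Z' U r
    unfolding achieved_def
  proof (intro ballI allI impI)
    fix x y p assume x: "x \<in> topspace X"
      and yp: "\<forall>l\<in>\<Lambda>. y l \<in> Z' l \<and> p l \<in> Z' l \<and> (\<forall>i\<in>W. p l i = r l i)"
    have "\<forall>l\<in>\<Lambda>. y l \<in> Z l \<and> p l \<in> Z l \<and> (\<forall>i\<in>W. p l i = r l i)" using yp sub by blast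
    then show "\<exists>k\<in>carrier G. a k x \<in> U \<and> (\<forall>l\<in>\<Lambda>. \<forall>i\<in>W. act k (y l) i = p l i)"
      by (rule ach[unfolded achieved_def, THEN bspec, OF x, THEN spec, THEN spec, THEN mp])
  qed
  define \<T> where "\<T> = \<U> \<times> (\<Pi>\<^sub>E l\<in>\<Lambda>. \<Pi>\<^sub>E i\<in>W. {0, 1, 2::real})"
  have fin\<T>: "finite \<T>" unfolding \<T>_def using \<U>(1) \<Lambda> W by (intro finite_cartesian_product finite_PiE) auto
  have "\<exists>Y'. (\<forall>l\<in>\<Lambda>. irreducible_shift (Y' l) \<and> Y' l \<subseteq> Y l) \<and>
      (\<forall>(U, r)\<in>\<T>'. achieved Y' U r)" if "\<T>' \<subseteq> \<T>" for \<T>'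
    using finite_subset[OF that fin\<T>] that
  proof (induction \<T>' rule: finite_induct)
    case empty
    then show ?case using Y by (intro exI[of _ Y]) auto
  next
    case (insert t \<T>')
    obtain U r where t: "t = (U, r)" by (cases t)
    then have U: "openin X U" "U \<noteq> {}" using insert.prems \<U>(2) by (auto simp: \<T>_def)
    obtain Y1 where Y1: "\<forall>l\<in>\<Lambda>. irreducible_shift (Y1 l) \<and> Y1 l \<subseteq> Y l"
      and ach1: "\<forall>(U, r)\<in>\<T>'. achieved Y1 U r"
      using insert.IH insert.prems by auto
    show ?case
    proof (cases "\<exists>q. \<forall>l\<in>\<Lambda>. q l \<in> Y1 l \<and> (\<forall>i\<in>W. q l i = r l i)")
      case False
      then have "achieved Y1 U r" unfolding achieved_def by blast
      then show ?thesis using Y1 ach1 t by (intro exI[of _ Y1]) auto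
    next
      case True
      then obtain q where q: "\<forall>l\<in>\<Lambda>. q l \<in> Y1 l \<and> (\<forall>i\<in>W. q l i = r l i)" by blast
      then have "\<forall>l\<in>\<Lambda>. irreducible_shift (Y1 l) \<and> q l \<in> Y1 l" using Y1 by blast
      from simultaneous_recurrence[OF X inf \<Lambda> this U W]
      obtain Y2 K where K: "finite K" "K \<subseteq> carrier G"
        and Y2: "\<forall>l\<in>\<Lambda>. irreducible_shift (Y2 l) \<and> Y2 l \<subseteq> Y1 l"
        and hit: "\<forall>x\<in>topspace X. \<forall>y. (\<forall>l\<in>\<Lambda>. y l \<in> Y2 l) \<longrightarrow>
          (\<exists>k\<in>K. a k x \<in> U \<and> (\<forall>l\<in>\<Lambda>. \<forall>i\<in>W. act k (y l) i = q l i))"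
        by (elim exE conjE)
      have "achieved Y2 U r" unfolding achieved_def
      proof (intro ballI allI impI)
        fix x y p assume x: "x \<in> topspace X"
          and yp: "\<forall>l\<in>\<Lambda>. y l \<in> Y2 l \<and> p l \<in> Y2 l \<and> (\<forall>i\<in>W. p l i = r l i)"
        obtain k where "k \<in> K" "a k x \<in> U" "\<forall>l\<in>\<Lambda>. \<forall>i\<in>W. act k (y l) i = q l i"
          using hit x yp by blast
        then show "\<exists>k\<in>carrier G. a k x \<in> U \<and> (\<forall>l\<in>\<Lambda>. \<forall>i\<in>W. act k (y l) i = p l i)"
          using K(2) q yp by (intro bexI[of _ k]) auto
      qed
      moreover have "\<forall>(U, r)\<in>\<T>'. achieved Y2 U r" 
      proof (intro ballI, unfold split_paired_all case_prod_conv)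
        fix U r assume "(U, r) \<in> \<T>'"
        then have "achieved Y1 U r" using ach1 by blast
        then show "achieved Y2 U r" by (rule mono) (use Y2 in blast)
      qed
      moreover have "\<forall>l\<in>\<Lambda>. irreducible_shift (Y2 l) \<and> Y2 l \<subseteq> Y l" using Y1 Y2 by fast
      ultimately show ?thesis using t by (intro exI[of _ Y2]) auto
    qed
  qed
  then obtain Y' where Y': "\<forall>l\<in>\<Lambda>. irreducible_shift (Y' l) \<and> Y' l \<subseteq> Y l"
    and ach: "\<forall>(U, r)\<in>\<T>. achieved Y' U r" using order_refl by blast
  have "\<exists>k\<in>carrier G. a k x \<in> U \<and> (\<forall>l\<in>\<Lambda>. \<forall>i\<in>W. act k (y l) i = p l i)"
    if h: "U \<in> \<U>" "x \<in> topspace X" "\<forall>l\<in>\<Lambda>. y l \<in> Y' l \<and> p l \<in> Y' l" for U x y p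
  proof -
    define r where "r = (\<lambda>l\<in>\<Lambda>. \<lambda>i\<in>W. p l i)"
    have "r \<in> (\<Pi>\<^sub>E l\<in>\<Lambda>. \<Pi>\<^sub>E i\<in>W. {0, 1, 2::real})"
      using h(3) Y' unfolding r_def irreducible_shift_def by (intro restrict_PiE_iff[THEN iffD2] ballI) blast
    then have "(U, r) \<in> \<T>" using h(1) by (simp add: \<T>_def)
    then have ach_r: "achieved Y' U r" using ach by blast
    have "\<forall>l\<in>\<Lambda>. y l \<in> Y' l \<and> p l \<in> Y' l \<and> (\<forall>i\<in>W. p l i = r l i)"
      using h(3) by (simp add: r_def)
    then show ?thesis
      by (rule ach_r[unfolded achieved_def, THEN bspec, OF h(2), THEN spec, THEN spec, THEN mp])
  qed
  then show ?thesis using Y' by (intro exI[of _ Y'] conjI ballI allI impI) simp_all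
qed

text \<open>The shifts form a binary tree: at stage \<open>n\<close> there is one for each subset of \<open>{..<n}\<close>, and all of
  them are shrunk simultaneously so as to be recurrent on the window \<open>{..<n}\<close>. The branches are indexed
  by the sets \<open>c\<close>.\<close>

lemma continuum_of_shifts:
  fixes U :: "nat \<Rightarrow> 'x set"
  assumes X: "minimal_flow G X a" and inf: "infinite (carrier G)"
    and U: "\<And>m. openin X (U m) \<and> U m \<noteq> {}" and Y0: "irreducible_shift Y0"
  shows "\<exists>Y. (\<forall>c. compact (Y c) \<and> Y c \<noteq> {} \<and> Y c \<subseteq> Y0 \<and> (\<forall>g\<in>carrier G. \<forall>y\<in>Y c. act g y \<in> Y c)) \<and>
    (\<forall>R m n x y p. finite R \<longrightarrow> x \<in> topspace X \<longrightarrow> (\<forall>c\<in>R. y c \<in> Y c \<and> p c \<in> Y c) \<longrightarrow>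
      (\<exists>k\<in>carrier G. a k x \<in> U m \<and> (\<forall>c\<in>R. \<forall>i<n. act k (y c) i = p (c :: nat set) i)))"
proof -
  define P where "P n Y \<longleftrightarrow> (\<forall>s\<in>Pow {..<n}. irreducible_shift (Y s) \<and> Y s \<subseteq> Y0)"
    for n :: nat and Y :: "nat set \<Rightarrow> (nat \<Rightarrow> real) set"
  \<comment> \<open>Window and list of open sets grow with \<open>n\<close>, so each finite window
    and each \<open>U m\<close> is eventually handled.\<close>
  define hits where "hits n Y' \<longleftrightarrow> (\<forall>V\<in>U ` {..n}. \<forall>x\<in>topspace X. \<forall>y p.
      (\<forall>s\<in>Pow {..<Suc n}. y s \<in> Y' s \<and> p s \<in> Y' s) \<longrightarrow>
      (\<exists>k\<in>carrier G. a k x \<in> V \<and> (\<forall>s\<in>Pow {..<Suc n}. \<forall>i\<in>{..<n}. act k (y s) i = p s i)))"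
    for n :: nat and Y' :: "nat set \<Rightarrow> (nat \<Rightarrow> real) set"
  \<comment> \<open>A node \<open>s\<close> of stage \<open>n + 1\<close> lies below its truncation;
    each node thus has two children, without and with the element \<open>n\<close>.\<close>
  define Q where "Q n Y Y' \<longleftrightarrow> (\<forall>s\<in>Pow {..<Suc n}. Y' s \<subseteq> Y (s \<inter> {..<n})) \<and> hits n Y'"
    for n :: nat and Y Y' :: "nat set \<Rightarrow> (nat \<Rightarrow> real) set"
  have "\<exists>F. \<forall>n. P n (F n) \<and> Q n (F n) (F (Suc n))"
  proof (rule dependent_nat_choice)
    show "\<exists>Y. P 0 Y" using Y0 by (intro exI[of _ "\<lambda>_. Y0"]) (simp add: P_def)
  next
    fix Y n assume PY: "P n Y"
    have Y: "\<forall>s\<in>Pow {..<Suc n}. irreducible_shift (Y (s \<inter> {..<n}))"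
      using PY by (auto simp: P_def)
    have \<U>: "\<forall>V\<in>U ` {..n}. openin X V \<and> V \<noteq> {}" using U by auto
    have fin: "finite (Pow {..<Suc n})" "finite (U ` {..n})" by auto
    from recurrence_of_all_patterns[OF X inf fin(1) Y fin(2) \<U> finite_lessThan[of n]]
    obtain Y' where Y': "\<forall>s\<in>Pow {..<Suc n}. irreducible_shift (Y' s) \<and> Y' s \<subseteq> Y (s \<inter> {..<n})"
      and hit: "hits n Y'"
      unfolding hits_def by (elim exE conjE)
    have "P (Suc n) Y'" unfolding P_def
    proof
      fix s assume s: "s \<in> Pow {..<Suc n}"
      then have "Y (s \<inter> {..<n}) \<subseteq> Y0" using PY by (auto simp: P_def)
      then show "irreducible_shift (Y' s) \<and> Y' s \<subseteq> Y0" using Y' s by blast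
    qed
    moreover have "Q n Y Y'" using Y' hit by (auto simp: Q_def)
    ultimately show "\<exists>Y'. P (Suc n) Y' \<and> Q n Y Y'" by blast
  qed
  then obtain F where F: "\<And>n. P n (F n)" "\<And>n. Q n (F n) (F (Suc n))" by blast
  define L where "L c n = F n (c \<inter> {..<n})" for c n
  have L_irr: "irreducible_shift (L c n)" and L_Y0: "L c n \<subseteq> Y0" for c n
    using F(1)[of n] by (auto simp: P_def L_def)
  have L_Suc: "L c (Suc n) \<subseteq> L c n" for c n
  proof -
    have "F (Suc n) (c \<inter> {..<Suc n}) \<subseteq> F n (c \<inter> {..<Suc n} \<inter> {..<n})"
      using F(2)[of n] by (auto simp: Q_def)
    moreover have "c \<inter> {..<Suc n} \<inter> {..<n} = c \<inter> {..<n}" by auto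
    ultimately show ?thesis by (simp add: L_def)
  qed
  have L_mono: "L c n \<subseteq> L c m" if "m \<le> n" for c m n
    using lift_Suc_antimono_le[of "L c", OF L_Suc that] .
  \<comment> \<open>The shifts decrease along a branch, and compactness of the ternary sequences
    keeps the intersection nonempty.\<close>
  define Y where "Y c = (\<Inter>n. L c n)" for c
  let ?C = "{y :: nat \<Rightarrow> real. \<forall>i. y i \<in> {0,1,2}}"
  have L_closed: "closed (L c n)" and L_C: "L c n \<subseteq> ?C" for c n
    using L_irr[of c n] unfolding irreducible_shift_def by blast+
  have Y_compact: "compact (Y c)" for c
  proof -
    have "Y c = ?C \<inter> Y c" using L_C[of c] by (auto simp: Y_def)
    moreover have "closed (Y c)" unfolding Y_def using L_closed by blast
    ultimately show ?thesis using compact_Int_closed[OF compact_ternary_sequences] by metis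
  qed
  have Y_ne: "Y c \<noteq> {}" for c
  proof -
    have "?C \<inter> (\<Inter>n\<in>UNIV. L c n) \<noteq> {}"
    proof (rule compact_imp_fip_image[OF compact_ternary_sequences])
      fix I' :: "nat set" assume I': "finite I'" "I' \<subseteq> UNIV"
      have "L c (Max (insert 0 I')) \<subseteq> L c n" if "n \<in> I'" for n
        using I'(1) that by (intro L_mono) simp
      moreover obtain y where "y \<in> L c (Max (insert 0 I'))"
        using irreducible_shift_nonempty[OF L_irr] by blast
      ultimately have "y \<in> ?C \<inter> (\<Inter>n\<in>I'. L c n)" using L_C by blast
      then show "?C \<inter> (\<Inter>n\<in>I'. L c n) \<noteq> {}" by blast
    qed (rule L_closed)
    then show ?thesis by (auto simp: Y_def)
  qed
  have Y_inv: "act g y \<in> Y c" if "g \<in> carrier G" "y \<in> Y c" for g y c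
    using that L_irr[of c] unfolding Y_def irreducible_shift_def by blast
  have Y_sub: "Y c \<subseteq> Y0" for c using L_Y0[of c] by (auto simp: Y_def)
  have "\<exists>k\<in>carrier G. a k x \<in> U m \<and> (\<forall>c\<in>R. \<forall>i<n. act k (y c) i = p c i)"
    if R: "finite R" and x: "x \<in> topspace X" and yp: "\<forall>c\<in>R. y c \<in> Y c \<and> p c \<in> Y c" for R m n x y p
  proof -
    obtain N0 where N0: "\<And>M. M \<ge> N0 \<Longrightarrow> \<forall>c\<in>R. \<forall>d\<in>R. c \<inter> {..<M} = d \<inter> {..<M} \<longrightarrow> c = d"
      using eventually_initial_segments_distinct[OF R] unfolding eventually_sequentially by blast
    \<comment> \<open>Late enough that the branches in \<open>R\<close> have separated, that
      \<open>U m\<close> is on the list, and that the window contains \<open>{..<n}\<close>.\<close>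
    define N where "N = max N0 (max m n)"
    define z where "z s = (SOME z. z \<in> F (Suc N) s)" for s
    \<comment> \<open>Turns data on the branches in \<open>R\<close> into data on all nodes of stage
      \<open>Suc N\<close>; nodes off these branches receive an arbitrary point.\<close>
    define lift where "lift u s = (if \<exists>c\<in>R. c \<inter> {..<Suc N} = s
        then u (THE c. c \<in> R \<and> c \<inter> {..<Suc N} = s) else z s)" for u :: "nat set \<Rightarrow> nat \<Rightarrow> real" and s
    have inj: "c = d" if "c \<in> R" "d \<in> R" "c \<inter> {..<Suc N} = d \<inter> {..<Suc N}" for c d
      using N0[of "Suc N"] that by (simp add: N_def)
    have lift_eq: "lift u (c \<inter> {..<Suc N}) = u c" if c: "c \<in> R" for u c
    proof -
      have "(THE d. d \<in> R \<and> d \<inter> {..<Suc N} = c \<inter> {..<Suc N}) = c"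
        using c inj by (intro the_equality) auto
      then show ?thesis using c by (auto simp: lift_def)
    qed
    have lift_in: "lift u s \<in> F (Suc N) s" if s: "s \<in> Pow {..<Suc N}" and u: "\<forall>c\<in>R. u c \<in> Y c" for u s
    proof (cases "\<exists>c\<in>R. c \<inter> {..<Suc N} = s")
      case True
      then obtain c where c: "c \<in> R" "c \<inter> {..<Suc N} = s" by blast
      have "u c \<in> L c (Suc N)" using u c(1) by (auto simp: Y_def)
      then show ?thesis using lift_eq[OF c(1), of u] c(2) by (simp add: L_def)
    next
      case False
      have "irreducible_shift (F (Suc N) s)" using F(1)[of "Suc N"] s by (auto simp: P_def)
      then have "z s \<in> F (Suc N) s"
        unfolding z_def using irreducible_shift_nonempty by (simp add: some_in_eq)
      then show ?thesis using False by (simp add: lift_def)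
    qed
    have "hits N (F (Suc N))" using F(2)[of N] by (simp add: Q_def)
    moreover have "U m \<in> U ` {..N}" by (simp add: N_def)
    moreover have "\<forall>s\<in>Pow {..<Suc N}. lift y s \<in> F (Suc N) s \<and> lift p s \<in> F (Suc N) s"
      using lift_in yp by blast
    ultimately have "\<exists>k\<in>carrier G. a k x \<in> U m \<and>
        (\<forall>s\<in>Pow {..<Suc N}. \<forall>i\<in>{..<N}. act k (lift y s) i = lift p s i)"
      unfolding hits_def using x by blast
    then obtain k where k: "k \<in> carrier G" "a k x \<in> U m"
      and eq: "\<forall>s\<in>Pow {..<Suc N}. \<forall>i\<in>{..<N}. act k (lift y s) i = lift p s i" by blast
    have "act k (y c) i = p c i" if "c \<in> R" "i < n" for c i
    proof -
      have "act k (lift y (c \<inter> {..<Suc N})) i = lift p (c \<inter> {..<Suc N}) i"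
        using eq that(2) by (simp add: N_def)
      then show ?thesis by (simp add: lift_eq[OF that(1)])
    qed
    then show ?thesis using k by blast
  qed
  then show ?thesis using Y_compact Y_ne Y_inv Y_sub
    by (intro exI[of _ Y] conjI allI impI ballI)
qed

end

section \<open>Free shifts and disjointness\<close>

text \<open>Here \<open>nat\<close> codes \<open>G \<times> nat\<close> with \<open>G\<close> acting by right translations. On level \<open>n\<close> the shift consists
  of the proper 3-colourings of the graph \<open>h - g\<^sub>n h\<close>; left multiplication commutes with the action, so
  this is invariant, and it forces \<open>y (g\<^sub>n, n) \<noteq> y (1, n)\<close>, hence \<open>g\<^sub>n y \<noteq> y\<close>.\<close>

lemma free_irreducible_shift_exists:
  fixes G (structure)
  assumes "group G" and count: "countable (carrier G)" and inf: "infinite (carrier G)"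
  shows "\<exists>\<sigma> Y. index_action G \<sigma> \<and> index_action.irreducible_shift G \<sigma> Y \<and>
    (\<forall>y\<in>Y. inj_on (\<lambda>g. index_action.act \<sigma> g y) (carrier G))"
proof -
  interpret group G by fact
  let ?S = "carrier G \<times> (UNIV :: nat set)"
  define e where "e = from_nat_into ?S"
  define u where "u = inv_into UNIV e"
  define gs where "gs = from_nat_into (carrier G)"
  have "countable ?S" "infinite ?S" using count inf by (auto simp: finite_cartesian_product_iff)
  then have bij: "bij_betw e UNIV ?S" unfolding e_def by (rule bij_betw_from_nat_into)
  have eu: "e (u (h, n)) = (h, n)" if "h \<in> carrier G" for h n
    unfolding u_def using that bij by (intro f_inv_into_f) (auto simp: bij_betw_def)
  have ue: "u (e i) = i" for i
    unfolding u_def using bij by (intro inv_into_f_f) (auto simp: bij_betw_def)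
  have e_in: "fst (e i) \<in> carrier G" for i
  proof -
    have "e i \<in> ?S" using bij_betwE[OF bij] by blast
    then show ?thesis by (simp add: mem_Times_iff)
  qed
  have e_eqI: "i = j" if "e i = e j" for i j using arg_cong[OF that, of u] unfolding ue .
  have range_gs: "range gs = carrier G"
    unfolding gs_def using count inf by (intro range_from_nat_into) auto
  then have gs_in: "gs n \<in> carrier G" for n by blast
  define \<sigma> where "\<sigma> k i = u (fst (e i) \<otimes> k, snd (e i))" for k i
  have e\<sigma>: "e (\<sigma> k i) = (fst (e i) \<otimes> k, snd (e i))" if "k \<in> carrier G" for k i
    unfolding \<sigma>_def using that e_in by (intro eu) auto
  interpret I: index_action G \<sigma>
  proof
    show "\<sigma> \<one> i = i" for i using e_in ue[of i] by (simp add: \<sigma>_def)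
    show "\<sigma> (g \<otimes> h) i = \<sigma> h (\<sigma> g i)" if "g \<in> carrier G" "h \<in> carrier G" for g h i
      using that e_in by (intro e_eqI) (simp add: e\<sigma> m_assoc)
    show "g = h" if "g \<in> carrier G" "h \<in> carrier G" "\<sigma> g i = \<sigma> h i" for g h i
    proof -
      have "fst (e i) \<otimes> g = fst (e i) \<otimes> h" using that e\<sigma>[of g i] e\<sigma>[of h i] by simp
      then show ?thesis using that e_in by simp
    qed
  qed
  \<comment> \<open>The graph is made undirected, and \<open>j \<noteq> i\<close> removes the loops
    on the levels where \<open>gs n\<close> is the identity.\<close>
  define nb where "nb i = {j. j \<noteq> i \<and> snd (e j) = snd (e i) \<and>
    (fst (e j) = gs (snd (e i)) \<otimes> fst (e i) \<or> fst (e i) = gs (snd (e i)) \<otimes> fst (e j))}" for i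
  have nb_sub: "nb i \<subseteq> {u (gs (snd (e i)) \<otimes> fst (e i), snd (e i)),
      u (inv (gs (snd (e i))) \<otimes> fst (e i), snd (e i))}" for i
  proof
    fix j assume j: "j \<in> nb i"
    then have "e j = (gs (snd (e i)) \<otimes> fst (e i), snd (e i)) \<or>
        e j = (inv (gs (snd (e i))) \<otimes> fst (e i), snd (e i))"
      using e_in gs_in by (auto simp: nb_def prod_eq_iff inv_solve_left)
    then show "j \<in> {u (gs (snd (e i)) \<otimes> fst (e i), snd (e i)),
      u (inv (gs (snd (e i))) \<otimes> fst (e i), snd (e i))}" using ue[of j] by auto
  qed
  have nb_fin: "finite (nb i)" for i using nb_sub finite_subset by blast
  have nb_card: "card (nb i) \<le> 2" for i
  proof -
    have "card (nb i) \<le> card {u (gs (snd (e i)) \<otimes> fst (e i), snd (e i)),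
        u (inv (gs (snd (e i))) \<otimes> fst (e i), snd (e i))}"
      using nb_sub by (intro card_mono) auto
    also have "\<dots> \<le> 2" by (simp add: card_insert_if)
    finally show ?thesis .
  qed
  have nb_sym: "i \<in> nb j" if "j \<in> nb i" for i j using that by (auto simp: nb_def)
  have nb_inv: "\<sigma> k j \<in> nb (\<sigma> k i)" if k: "k \<in> carrier G" and j: "j \<in> nb i" for k i j
  proof -
    have "j \<noteq> i" using j by (simp add: nb_def)
    then have "\<sigma> k j \<noteq> \<sigma> k i" using I.\<sigma>_inv[OF k, of j] I.\<sigma>_inv[OF k, of i] by auto
    then show ?thesis using j k e_in gs_in by (auto simp: nb_def e\<sigma> m_assoc)
  qed
  define Y where "Y = {y :: nat \<Rightarrow> real. (\<forall>i. y i \<in> {0,1,2}) \<and> (\<forall>i. \<forall>j\<in>nb i. y i \<noteq> y j)}"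
  define adj where "adj i j \<longleftrightarrow> j = i \<or> j \<in> nb i" for i j
  have "I.local_rel adj"
    unfolding I.local_rel_def
  proof (intro conjI allI impI ballI)
    show "finite {j. adj i j}" for i
    proof -
      have "{j. adj i j} = insert i (nb i)" by (auto simp: adj_def)
      then show ?thesis using nb_fin by simp
    qed
  qed (auto simp: adj_def nb_sym nb_inv)
  moreover have "I.glues adj Y"
    unfolding I.glues_def
  proof (intro allI impI, elim conjE)
    fix E c assume cY: "\<forall>i\<in>E. c i \<in> Y" and cc: "\<forall>i\<in>E. \<forall>j\<in>E. adj i j \<longrightarrow> c i = c j"
    \<comment> \<open>Neighbours in \<open>E\<close> copy from one proper colouring, so the
      prescribed values form a proper partial colouring, which extends greedily.\<close>
    have "\<exists>f. (\<forall>i. f i \<in> {0,1,2}) \<and> (\<forall>i\<in>E. f i = c i i) \<and> (\<forall>i. \<forall>j\<in>nb i. f i \<noteq> f j)"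
    proof (rule greedy_three_colouring[OF nb_fin nb_card nb_sym])
      show "i \<notin> nb i" for i by (simp add: nb_def)
      show "c i i \<in> {0,1,2}" if "i \<in> E" for i using cY that by (auto simp: Y_def)
      show "c i i \<noteq> c j j" if ij: "i \<in> E" "j \<in> E" "j \<in> nb i" for i j
      proof -
        have "c i = c j" using cc ij by (auto simp: adj_def)
        moreover have "c i i \<noteq> c i j" using cY ij by (auto simp: Y_def)
        ultimately show ?thesis by simp
      qed
    qed
    then show "\<exists>x\<in>Y. \<forall>i\<in>E. x i = c i i" unfolding Y_def by blast
  qed
  moreover have "closed Y"
  proof -
    \<comment> \<open>Among the values 0, 1, 2 being different means having distance at least 1,
      which is a closed condition.\<close>
    have eq: "Y = (\<Inter>i. {y. y i = 0} \<union> {y. y i = 1} \<union> {y. y i = 2}) \<inter>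
        (\<Inter>i. \<Inter>j\<in>nb i. {y. \<bar>y i - y j\<bar> \<ge> 1})"
    proof (rule Set.set_eqI)
      fix y :: "nat \<Rightarrow> real"
      have *: "y i \<noteq> y j \<longleftrightarrow> \<bar>y i - y j\<bar> \<ge> 1" if "\<forall>i. y i \<in> {0,1,2}" for i j
        using that[THEN spec, of i] that[THEN spec, of j] by auto
      show "y \<in> Y \<longleftrightarrow> y \<in> (\<Inter>i. {y. y i = 0} \<union> {y. y i = 1} \<union> {y. y i = 2}) \<inter>
        (\<Inter>i. \<Inter>j\<in>nb i. {y. \<bar>y i - y j\<bar> \<ge> 1})"
      proof (cases "\<forall>i. y i \<in> {0,1,2}")
        case True
        then show ?thesis using *[OF True] by (auto simp: Y_def)
      next
        case False
        then show ?thesis by (auto simp: Y_def)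
      qed
    qed
    show ?thesis unfolding eq
      by (intro closed_Int closed_INT closed_Un ballI closed_coordinate_eq closed_Collect_le
          continuous_intros continuous_on_product_coordinates)
  qed
  moreover have "I.act g y \<in> Y" if "g \<in> carrier G" "y \<in> Y" for g y
    using that nb_inv by (auto simp: Y_def I.act_def)
  moreover have "\<forall>y\<in>Y. \<forall>i. y i \<in> {0,1,2}" by (simp add: Y_def)
  ultimately have "I.irreducible_shift Y" unfolding I.irreducible_shift_def by blast
  moreover have "inj_on (\<lambda>g. I.act g y) (carrier G)" if y: "y \<in> Y" for y
  proof (rule inj_onI, rule ccontr)
    fix g h assume gh: "g \<in> carrier G" "h \<in> carrier G" "I.act g y = I.act h y" "g \<noteq> h"
    \<comment> \<open>The level that separates \<open>g\<close> from \<open>h\<close>: there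
      \<open>(g, n)\<close> and \<open>(h, n)\<close> are neighbours, because
      \<open>g = gs n \<otimes> h\<close>.\<close>
    obtain n where n: "gs n = g \<otimes> inv h"
    proof -
      have "g \<otimes> inv h \<in> range gs" unfolding range_gs using gh(1,2) by simp
      then show ?thesis using that by auto
    qed
    let ?i = "u (\<one>, n)"
    have ei: "e ?i = (\<one>, n)" by (simp add: eu)
    have "e (\<sigma> g ?i) = (g, n)" "e (\<sigma> h ?i) = (h, n)" using gh by (simp_all add: e\<sigma> ei)
    then have "\<sigma> g ?i \<in> nb (\<sigma> h ?i)" using gh n by (auto simp: nb_def m_assoc)
    then have "y (\<sigma> h ?i) \<noteq> y (\<sigma> g ?i)" using y by (auto simp: Y_def)
    moreover have "y (\<sigma> g ?i) = y (\<sigma> h ?i)" using fun_cong[OF gh(3), of ?i] by (simp add: I.act_def)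
    ultimately show False by simp
  qed
  ultimately show ?thesis using I.index_action_axioms by blast
qed

text \<open>The only place where metrizability of \<open>X\<close> enters. Balls of radius
  \<open>1 / Suc n\<close> around finite nets work; density of orbits is tested by nonempty open
  sets, so a family inside all of these is enough.\<close>

lemma compact_metrizable_countable_pi_base:
  assumes "compact_space X" "metrizable_space X" "topspace X \<noteq> {}"
  shows "\<exists>U :: nat \<Rightarrow> 'x set. (\<forall>m. openin X (U m) \<and> U m \<noteq> {}) \<and>
    (\<forall>V. openin X V \<and> V \<noteq> {} \<longrightarrow> (\<exists>m. U m \<subseteq> V))"
proof -
  obtain M d where M: "Metric_space M d" and X: "X = Metric_space.mtopology M d"
    using assms(2) by (auto simp: metrizable_space_def)
  interpret Metric_space M d by fact
  have tb: "mtotally_bounded M"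
    using assms(1) by (simp add: X compact_space_eq_mcomplete_mtotally_bounded)
  have "\<exists>K. finite K \<and> K \<subseteq> M \<and> M \<subseteq> (\<Union>x\<in>K. mball x (1 / Suc n))" for n
    using tb unfolding mtotally_bounded_def by simp
  then obtain K where K: "\<And>n. finite (K n)" "\<And>n. K n \<subseteq> M" "\<And>n. M \<subseteq> (\<Union>x\<in>K n. mball x (1 / Suc n))"
    by metis
  define \<B> where "\<B> = (\<Union>n. (\<lambda>x. mball x (1 / Suc n)) ` K n)"
  have "countable \<B>" unfolding \<B>_def using K(1) by (intro countable_UN) (auto simp: countable_finite)
  moreover have "M \<noteq> {}" using assms(3) by (simp add: X)
  then have "\<B> \<noteq> {}" unfolding \<B>_def using K(3)[of 0] by auto
  ultimately have ran: "range (from_nat_into \<B>) = \<B>" by (rule range_from_nat_into[rotated])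
  have op: "openin X B \<and> B \<noteq> {}" if "B \<in> \<B>" for B
    using that K(2) by (fastforce simp: \<B>_def X)
  have "\<exists>B\<in>\<B>. B \<subseteq> V" if V: "openin X V" "V \<noteq> {}" for V
  proof -
    obtain x r where x: "x \<in> V" "r > 0" "mball x r \<subseteq> V"
      using V unfolding X openin_mtopology by blast
    have xM: "x \<in> M" using x(1) V(1) openin_subset[OF V(1)] by (auto simp: X)
    obtain n where n: "1 / Suc n < r / 2"
      using reals_Archimedean[of "r / 2"] x(2) by (auto simp: inverse_eq_divide)
    obtain c where c: "c \<in> K n" "x \<in> mball c (1 / Suc n)" using K(3)[of n] xM by blast
    have "mball c (1 / Suc n) \<subseteq> mball x r"
    proof
      fix z assume z: "z \<in> mball c (1 / Suc n)"
      then have "d x z \<le> d x c + d c z" using xM c(2) by (intro triangle) auto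
      also have "\<dots> < r" using z c(2) n by (simp add: commute)
      finally show "z \<in> mball x r" using z xM by simp
    qed
    then show ?thesis using x(3) c(1) by (auto simp: \<B>_def)
  qed
  then have "\<exists>m. from_nat_into \<B> m \<subseteq> V" if "openin X V" "V \<noteq> {}" for V
    using ran that by (metis imageE)
  moreover have "from_nat_into \<B> m \<in> \<B>" for m using ran by blast
  ultimately show ?thesis using op by (intro exI[of _ "from_nat_into \<B>"]) blast
qed

text \<open>A basic open set restricts finitely many coordinates, which lie in some
  \<open>{..<n}\<close>; this matches the windows of the tree.\<close>

lemma open_sequence_space_window:
  fixes V :: "(nat \<Rightarrow> real) set"
  assumes "open V" "p \<in> V"
  shows "\<exists>n. \<forall>z. (\<forall>i<n. z i = p i) \<longrightarrow> z \<in> V"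
proof -
  have "openin (product_topology (\<lambda>i. euclidean) UNIV) V"
    using assms(1) by (simp add: euclidean_product_topology)
  from product_topology_open_contains_basis[OF this assms(2)]
  obtain B where B: "p \<in> (\<Pi>\<^sub>E i\<in>UNIV. B i)" "finite {i. B i \<noteq> topspace (euclidean :: real topology)}"
      "(\<Pi>\<^sub>E i\<in>UNIV. B i) \<subseteq> V"
    by blast
  obtain n where n: "\<And>i. B i \<noteq> UNIV \<Longrightarrow> i < n"
    using B(2) finite_nat_set_iff_bounded[of "{i. B i \<noteq> UNIV}"] by auto
  have "z \<in> V" if z: "\<forall>i<n. z i = p i" for z
  proof -
    have "z i \<in> B i" for i
      using B(1) n[of i] z by (cases "B i = UNIV") auto
    then show ?thesis using B(3) by auto
  qed
  then show ?thesis by blast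
qed

text \<open>Rational cuts turn reals into branches of the tree.\<close>

lemma real_inj_nat_set: "\<exists>code :: real \<Rightarrow> nat set. inj code"
proof (intro exI injI)
  define code where "code r = {n. r < of_rat (from_nat n)}" for r :: real
  have less: "code r \<noteq> code s" if rs: "r < s" for r s
  proof -
    obtain q where q: "r < of_rat q" "of_rat q < s" using of_rat_dense[OF rs] by blast
    then have "to_nat q \<in> code r" "to_nat q \<notin> code s" by (auto simp: code_def)
    then show ?thesis by blast
  qed
  fix r s assume "code r = code s"
  then show "r = s" using less[of r s] less[of s r] by (cases r s rule: linorder_cases) auto
qed

section \<open>Flows from the branches, and the passage from windows to open sets\<close>

context index_action
begin

lemma subshift_G_flow:
  assumes "compact Y" "Y \<noteq> {}" "\<And>g y. g \<in> carrier G \<Longrightarrow> y \<in> Y \<Longrightarrow> act g y \<in> Y"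
  shows "G_flow G (top_of_set Y) act"
proof -
  have "continuous_on Y (act g)" for g
    unfolding act_def
    by (intro continuous_on_coordinatewise_then_product continuous_on_subset[OF continuous_on_product_coordinates]) simp
  then show ?thesis
    unfolding G_flow_def using assms group_axioms act_mult
    by (auto simp: compact_space_subtopology Hausdorff_space_subtopology)
qed

end

text \<open>The last condition says that the product of \<open>X\<close> with all the \<open>Y c\<close> is minimal.\<close>

definition jointly_recurrent_subshifts ::
  "('g, 'b) monoid_scheme \<Rightarrow> 'x topology \<Rightarrow> ('g \<Rightarrow> 'x \<Rightarrow> 'x) \<Rightarrow> ('g \<Rightarrow> (nat \<Rightarrow> real) \<Rightarrow> nat \<Rightarrow> real)
    \<Rightarrow> (nat set \<Rightarrow> (nat \<Rightarrow> real) set) \<Rightarrow> bool" where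
  "jointly_recurrent_subshifts G X a b Y \<longleftrightarrow>
    (\<forall>c. free_flow G (top_of_set (Y c)) b) \<and>
    (\<forall>R V W x y. finite R \<longrightarrow> openin X V \<longrightarrow> V \<noteq> {} \<longrightarrow> x \<in> topspace X \<longrightarrow>
      (\<forall>c\<in>R. openin (top_of_set (Y c)) (W c) \<and> W c \<noteq> {} \<and> y c \<in> Y c) \<longrightarrow>
      (\<exists>k\<in>carrier G. a k x \<in> V \<and> (\<forall>c\<in>R. b k (y c) \<in> W c)))"

lemma jointly_recurrent_subshifts_exist:
  fixes G :: "('g, 'b) monoid_scheme" and X :: "'x topology"
  assumes "group G" "countable (carrier G)" and inf: "infinite (carrier G)"
    and X: "minimal_flow G X a" "metrizable_space X"
  shows "\<exists>b Y. jointly_recurrent_subshifts G X a b Y"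
proof -
  obtain \<sigma> Y0 where \<sigma>: "index_action G \<sigma>" and Y0: "index_action.irreducible_shift G \<sigma> Y0"
    and free: "\<forall>y\<in>Y0. inj_on (\<lambda>g. index_action.act \<sigma> g y) (carrier G)"
    using free_irreducible_shift_exists[OF assms(1-3)] by (elim exE conjE)
  interpret index_action G \<sigma> by (rule \<sigma>)
  have "compact_space X" "topspace X \<noteq> {}" using X(1) by (auto simp: minimal_flow_def G_flow_def)
  then obtain U :: "nat \<Rightarrow> 'x set" where U: "\<forall>m. openin X (U m) \<and> U m \<noteq> {}"
    and base: "\<forall>V. openin X V \<and> V \<noteq> {} \<longrightarrow> (\<exists>m. U m \<subseteq> V)"
    using compact_metrizable_countable_pi_base[OF _ X(2)] by (elim meta_impE exE conjE)
  obtain Y where Y: "\<forall>c. compact (Y c) \<and> Y c \<noteq> {} \<and> Y c \<subseteq> Y0 \<and> (\<forall>g\<in>carrier G. \<forall>y\<in>Y c. act g y \<in> Y c)"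
    and hit: "\<forall>R m n x y p. finite R \<longrightarrow> x \<in> topspace X \<longrightarrow> (\<forall>c\<in>R. y c \<in> Y c \<and> p c \<in> Y c) \<longrightarrow>
      (\<exists>k\<in>carrier G. a k x \<in> U m \<and> (\<forall>c\<in>R. \<forall>i<n. act k (y c) i = p (c :: nat set) i))"
    using continuum_of_shifts[where U = U, OF X(1) inf U[THEN spec] Y0] by (elim exE conjE)
  have "G_flow G (top_of_set (Y c)) act" for c
    using Y by (intro subshift_G_flow) auto
  moreover have "inj_on (\<lambda>g. act g y) (carrier G)" if "y \<in> Y c" for y c
    using free Y that by blast
  ultimately have "\<forall>c. free_flow G (top_of_set (Y c)) act" by (simp add: free_flow_def)
  moreover have "\<exists>k\<in>carrier G. a k x \<in> V \<and> (\<forall>c\<in>R. act k (y c) \<in> W c)"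
    if R: "finite R" and V: "openin X V" "V \<noteq> {}" and x: "x \<in> topspace X"
      and W: "\<forall>c\<in>R. openin (top_of_set (Y c)) (W c) \<and> W c \<noteq> {} \<and> y c \<in> Y c" for R V W x y
  proof -
    obtain m where m: "U m \<subseteq> V" using base V by blast
    have "\<exists>p n. p \<in> Y c \<and> (\<forall>z\<in>Y c. (\<forall>i<n. z i = p i) \<longrightarrow> z \<in> W c)" if c: "c \<in> R" for c
    proof -
      obtain T where T: "open T" "W c = Y c \<inter> T" using W c by (auto simp: openin_open)
      obtain p where p: "p \<in> W c" using W c by blast
      then obtain n where "\<forall>z. (\<forall>i<n. z i = p i) \<longrightarrow> z \<in> T"
        using open_sequence_space_window[OF T(1)] T(2) by blast
      then show ?thesis using p T(2) by blast
    qed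
    then obtain p n where p: "\<And>c. c \<in> R \<Longrightarrow> p c \<in> Y c"
      and n: "\<And>c z. c \<in> R \<Longrightarrow> z \<in> Y c \<Longrightarrow> \<forall>i<n c. z i = p c i \<Longrightarrow> z \<in> W c"
      by metis
    \<comment> \<open>A common window for all factors; the sum bounds each \<open>n c\<close> and
      also makes sense for \<open>R = {}\<close>.\<close>
    define N where "N = (\<Sum>c\<in>R. n c)"
    have N: "n c \<le> N" if "c \<in> R" for c unfolding N_def using R that by (simp add: member_le_sum)
    have "\<forall>c\<in>R. y c \<in> Y c \<and> p c \<in> Y c" using W p by blast
    then have "\<exists>k\<in>carrier G. a k x \<in> U m \<and> (\<forall>c\<in>R. \<forall>i<N. act k (y c) i = p c i)"
      by (rule hit[THEN spec, THEN spec, THEN spec, THEN spec, THEN spec, THEN spec, THEN mp, THEN mp, THEN mp, OF R x])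
    then obtain k where k: "k \<in> carrier G" "a k x \<in> U m" "\<forall>c\<in>R. \<forall>i<N. act k (y c) i = p c i" by blast
    have "act k (y c) \<in> W c" if c: "c \<in> R" for c
    proof (rule n[OF c])
      show "act k (y c) \<in> Y c" using Y k(1) W c by blast
      show "\<forall>i<n c. act k (y c) i = p c i" using k(3) N[OF c] c by auto
    qed
    then show ?thesis using k m by blast
  qed
  ultimately have "jointly_recurrent_subshifts G X a act Y"
    unfolding jointly_recurrent_subshifts_def by (intro conjI allI impI) simp_all
  then show ?thesis by blast
qed

lemma jointly_recurrent_free:
  "jointly_recurrent_subshifts G X a b Y \<Longrightarrow> free_flow G (top_of_set (Y c)) b"
  by (simp add: jointly_recurrent_subshifts_def)

text \<open>The case of a single index with the whole of \<open>X\<close> as open set;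
  \<open>X\<close> only has to supply a point.\<close>

lemma jointly_recurrent_minimal:
  assumes Y: "jointly_recurrent_subshifts G X a b Y" and X: "topspace X \<noteq> {}"
  shows "minimal_flow G (top_of_set (Y c)) b"
  unfolding minimal_flow_def
proof (intro conjI ballI)
  show "G_flow G (top_of_set (Y c)) b"
    using Y by (simp add: jointly_recurrent_subshifts_def free_flow_def)
  fix y assume y: "y \<in> topspace (top_of_set (Y c))"
  obtain x where x: "x \<in> topspace X" using X by blast
  have "\<exists>z. z \<in> orbit G b y \<and> z \<in> W" if W: "openin (top_of_set (Y c)) W" "p \<in> W" for p W
  proof -
    have "\<exists>k\<in>carrier G. a k x \<in> topspace X \<and> (\<forall>d\<in>{c}. b k y \<in> W)"
      using Y[unfolded jointly_recurrent_subshifts_def, THEN conjunct2, THEN spec, THEN spec, THEN spec,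
          THEN spec, THEN spec, of "{c}" "topspace X" x "\<lambda>_. W" "\<lambda>_. y"] x y W X by auto
    then show ?thesis by (auto simp: orbit_def)
  qed
  then have "topspace (top_of_set (Y c)) \<subseteq> (top_of_set (Y c)) closure_of (orbit G b y)"
    unfolding in_closure_of subset_iff by blast
  then show "(top_of_set (Y c)) closure_of (orbit G b y) = topspace (top_of_set (Y c))"
    using closure_of_subset_topspace by (metis subset_antisym)
qed

text \<open>The orbit of one point of \<open>Z\<close> meets every nonempty open box, so a closed
  invariant \<open>Z\<close> leaves no room for a complement.\<close>

lemma jointly_recurrent_disjoint:
  assumes Y: "jointly_recurrent_subshifts G X a b Y" and X: "topspace X \<noteq> {}"
  shows "disjoint_flows G X a (top_of_set (Y c)) b"
  unfolding disjoint_flows_def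
proof (intro allI impI, elim conjE)
  let ?Y = "top_of_set (Y c)"
  fix Z assume Z: "closedin (prod_topology X ?Y) Z"
    and inv: "\<forall>g\<in>carrier G. \<forall>p\<in>Z. (a g (fst p), b g (snd p)) \<in> Z" and fst: "fst ` Z = topspace X"
  have Z_sub: "Z \<subseteq> topspace X \<times> topspace ?Y" using closedin_subset[OF Z] by simp
  have "Z \<noteq> {}" using X fst by blast
  then obtain x y where xy: "(x, y) \<in> Z" by auto
  have xy': "x \<in> topspace X" "y \<in> Y c" using xy Z_sub by auto
  have "(u, v) \<in> Z" if uv: "u \<in> topspace X" "v \<in> topspace ?Y" for u v
  proof (rule ccontr)
    assume "(u, v) \<notin> Z"
    then have mem: "(u, v) \<in> topspace (prod_topology X ?Y) - Z" using uv by simp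
    have "openin (prod_topology X ?Y) (topspace (prod_topology X ?Y) - Z)"
      using Z by blast
    from this[unfolded openin_prod_topology_alt, THEN spec, THEN spec, THEN mp, OF mem]
    obtain V W where VW: "openin X V" "openin ?Y W" "u \<in> V" "v \<in> W"
        "V \<times> W \<subseteq> topspace (prod_topology X ?Y) - Z"
      by (elim exE conjE)
    have "\<exists>k\<in>carrier G. a k x \<in> V \<and> (\<forall>d\<in>{c}. b k y \<in> W)"
      using Y[unfolded jointly_recurrent_subshifts_def, THEN conjunct2, THEN spec, THEN spec, THEN spec,
          THEN spec, THEN spec, of "{c}" V x "\<lambda>_. W" "\<lambda>_. y"] xy' VW by auto
    then obtain k where k: "k \<in> carrier G" "a k x \<in> V" "b k y \<in> W" by blast
    have "(a k x, b k y) \<in> Z" using inv k(1) xy by force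
    then show False using VW(5) k by blast
  qed
  then show "Z = topspace X \<times> topspace ?Y" using Z_sub by auto
qed

text \<open>A basic open set of the product restricts finitely many factors, so recurrence for
  finite \<open>R\<close> already makes every diagonal orbit dense.\<close>

lemma jointly_recurrent_mutually_disjoint:
  fixes code :: "real \<Rightarrow> nat set"
  assumes Y: "jointly_recurrent_subshifts G X a b Y" and X: "topspace X \<noteq> {}" and code: "inj code"
  shows "mutually_disjoint G UNIV (\<lambda>r. top_of_set (Y (code r))) (\<lambda>r. b)"
proof -
  let ?Y = "\<lambda>r. top_of_set (Y (code r))"
  let ?P = "product_topology ?Y UNIV" and ?d = "diag_action UNIV (\<lambda>r. b)"
  have flow: "G_flow G (?Y r) b" for r
    using Y by (simp add: jointly_recurrent_subshifts_def free_flow_def)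
  have d: "?d g f = (\<lambda>r. b g (f r))" for g f by (simp add: diag_action_def restrict_def)
  have top: "f \<in> topspace ?P \<longleftrightarrow> (\<forall>r. f r \<in> Y (code r))" for f by (auto simp: PiE_iff)
  have b_one: "b \<one>\<^bsub>G\<^esub> y = y" if "y \<in> Y (code r)" for r y
    using flow[of r] that by (simp add: G_flow_def)
  have b_mult: "b (g \<otimes>\<^bsub>G\<^esub> h) y = b g (b h y)"
    if "g \<in> carrier G" "h \<in> carrier G" "y \<in> Y (code r)" for g h r y
    using flow[of r] that by (simp add: G_flow_def)
  have "group G" using flow by (auto simp: G_flow_def)
  moreover have "compact_space ?P"
    using flow unfolding compact_space_product_topology G_flow_def by blast
  moreover have "Hausdorff_space ?P"
    using flow unfolding Hausdorff_space_product_topology G_flow_def by blast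
  moreover have "topspace ?P \<noteq> {}"
    using flow by (simp add: G_flow_def PiE_eq_empty_iff)
  moreover have "continuous_map ?P ?P (?d g)" if g: "g \<in> carrier G" for g
    unfolding continuous_map_componentwise_UNIV d
  proof
    fix r
    have "continuous_map ?P (?Y r) (b g \<circ> (\<lambda>f. f r))"
      using flow[of r] g by (intro continuous_map_compose[OF continuous_map_product_projection])
        (auto simp: G_flow_def)
    then show "continuous_map ?P (?Y r) (\<lambda>f. b g (f r))" by (simp add: comp_def)
  qed
  moreover have "?d \<one>\<^bsub>G\<^esub> f = f" if "f \<in> topspace ?P" for f
    unfolding d using b_one that[unfolded top] by blast
  moreover have "?d (g \<otimes>\<^bsub>G\<^esub> h) f = ?d g (?d h f)"
    if "g \<in> carrier G" "h \<in> carrier G" "f \<in> topspace ?P" for g h f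
    unfolding d using b_mult[OF that(1,2)] that(3)[unfolded top] by blast
  ultimately have "G_flow G ?P ?d" unfolding G_flow_def by blast
  moreover have "?P closure_of (orbit G ?d f) = topspace ?P" if f: "f \<in> topspace ?P" for f
  proof
    show "?P closure_of (orbit G ?d f) \<subseteq> topspace ?P" by (rule closure_of_subset_topspace)
    show "topspace ?P \<subseteq> ?P closure_of (orbit G ?d f)"
    proof
      fix p assume p: "p \<in> topspace ?P"
      have "\<exists>z. z \<in> orbit G ?d f \<and> z \<in> T" if T: "openin ?P T" "p \<in> T" for T
      proof -
        from product_topology_open_contains_basis[OF T]
        obtain W where W: "p \<in> (\<Pi>\<^sub>E r\<in>UNIV. W r)" "\<forall>r. openin (?Y r) (W r)"
            "finite {r. W r \<noteq> topspace (?Y r)}" "(\<Pi>\<^sub>E r\<in>UNIV. W r) \<subseteq> T"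
          by blast
        define R where "R = {r. W r \<noteq> topspace (?Y r)}"
        obtain x where x: "x \<in> topspace X" using X by blast
        define dec where "dec = inv_into UNIV code"
        have dec: "dec (code r) = r" for r using code by (simp add: dec_def)
        have "\<forall>c\<in>code ` R. openin (top_of_set (Y c)) (W (dec c)) \<and> W (dec c) \<noteq> {} \<and>
            f (dec c) \<in> Y c"
        proof (rule ballI)
          fix c assume "c \<in> code ` R"
          then obtain r where r: "c = code r" by blast
          have "p r \<in> W r" using W(1) by auto
          then show "openin (top_of_set (Y c)) (W (dec c)) \<and> W (dec c) \<noteq> {} \<and>
            f (dec c) \<in> Y c" using W(2) f unfolding r dec top by blast
        qed
        moreover have "finite (code ` R)" using W(3) by (simp add: R_def)
        ultimately obtain k where k: "k \<in> carrier G" "\<forall>c\<in>code ` R. b k (f (dec c)) \<in> W (dec c)"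
          using Y[unfolded jointly_recurrent_subshifts_def, THEN conjunct2, THEN spec, THEN spec, THEN spec,
            THEN spec, THEN spec, of "code ` R" "topspace X" x "\<lambda>c. W (dec c)" "\<lambda>c. f (dec c)"]
            X x by auto
        have "b k (f r) \<in> W r" for r
        proof (cases "r \<in> R")
          case True
          then show ?thesis using k(2) dec by force
        next
          case False
          have "f r \<in> topspace (?Y r)" using f[unfolded top] by simp
          then have "b k (f r) \<in> topspace (?Y r)"
            using flow[of r] k(1) unfolding G_flow_def continuous_map_def by blast
          then show ?thesis using False by (simp add: R_def)
        qed
        then have "?d k f \<in> T" using W(4) unfolding d by (auto simp: PiE_iff)
        then show ?thesis using k(1) by (auto simp: orbit_def)
      qed
      then show "p \<in> ?P closure_of (orbit G ?d f)" using p unfolding in_closure_of by blast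
    qed
  qed
  ultimately have "minimal_flow G ?P ?d" by (simp add: minimal_flow_def)
  then show ?thesis using jointly_recurrent_minimal[OF Y X] by (simp add: mutually_disjoint_def)
qed

theorem theorem1p2:
  fixes G :: "('g, 'b) monoid_scheme"
  assumes "group G" and "countable (carrier G)" and "infinite (carrier G)"
  shows "(\<forall>(X :: 'x topology) a. minimal_flow G X a \<and> metrizable_space X \<longrightarrow>
            (\<exists>(Y :: (nat \<Rightarrow> real) topology) b.
               minimal_flow G Y b \<and> metrizable_space Y \<and> free_flow G Y b \<and>
               disjoint_flows G X a Y b))
       \<and> (\<exists>(Xs :: real \<Rightarrow> (nat \<Rightarrow> real) topology) as.
            mutually_disjoint G UNIV Xs as \<and>
            (\<forall>r. free_flow G (Xs r) (as r) \<and> metrizable_space (Xs r) \<and> minimal_flow G (Xs r) (as r)))"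
proof (intro conjI allI impI)
  have metr: "metrizable_space (top_of_set S)" for S :: "(nat \<Rightarrow> real) set"
    by (intro metrizable_space_subtopology metrizable_space_euclidean)
  {
    fix X :: "'x topology" and a
    assume X: "minimal_flow G X a \<and> metrizable_space X"
    then have ne: "topspace X \<noteq> {}" by (simp add: minimal_flow_def G_flow_def)
    obtain b Y where Y: "jointly_recurrent_subshifts G X a b Y"
      using jointly_recurrent_subshifts_exist[OF assms] X by blast
    show "\<exists>(Y :: (nat \<Rightarrow> real) topology) b.
        minimal_flow G Y b \<and> metrizable_space Y \<and> free_flow G Y b \<and> disjoint_flows G X a Y b"
      \<comment> \<open>Any branch of the tree serves; \<open>{}\<close> is one.\<close>
      by (intro exI[of _ "top_of_set (Y {})"] exI[of _ b] conjI jointly_recurrent_minimal[OF Y ne] metr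
          jointly_recurrent_free[OF Y] jointly_recurrent_disjoint[OF Y ne])
  }
  \<comment> \<open>Over the one-point flow joint recurrence speaks of the shifts alone.\<close>
  let ?X = "discrete_topology {()}" and ?a = "\<lambda>_::'g. id :: unit \<Rightarrow> unit"
  have "G_flow G ?X ?a"
    using assms(1) unfolding G_flow_def by (simp add: compact_space_discrete_topology)
  moreover have "?X closure_of (orbit G ?a x) = topspace ?X" for x
  proof -
    have "carrier G \<noteq> {}" using assms(3) by (rule contrapos_nn) simp
    then have "orbit G ?a x = {x}" unfolding orbit_def id_apply by (simp only: image_constant_conv if_False)
    then have "orbit G ?a x = topspace ?X" by (cases x) (simp only: topspace_discrete_topology)
    then show ?thesis by (simp only: closure_of_topspace)
  qed
  ultimately have X: "minimal_flow G ?X ?a" unfolding minimal_flow_def by blast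
  have "metrizable_space ?X" by (rule metrizable_space_discrete_topology)
  then obtain b Y where Y: "jointly_recurrent_subshifts G ?X ?a b Y"
    using jointly_recurrent_subshifts_exist[OF assms X] by blast
  obtain code :: "real \<Rightarrow> nat set" where code: "inj code" using real_inj_nat_set by blast
  have ne: "topspace ?X \<noteq> {}" by simp
  show "\<exists>(Xs :: real \<Rightarrow> (nat \<Rightarrow> real) topology) as. mutually_disjoint G UNIV Xs as \<and>
      (\<forall>r. free_flow G (Xs r) (as r) \<and> metrizable_space (Xs r) \<and> minimal_flow G (Xs r) (as r))"
    by (intro exI[of _ "\<lambda>r. top_of_set (Y (code r))"] exI[of _ "\<lambda>_. b"] conjI allI metr
        jointly_recurrent_mutually_disjoint[OF Y ne code] jointly_recurrent_minimal[OF Y ne]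
        jointly_recurrent_free[OF Y])
qed

end
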